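(* Let $C$ be a unital associative conformal algebra over $\mathbb{C}$ with conformal identity $e$, and suppose that the left annihilator of $C$ is trivial, $L(C)=0$. Then there exist an associative algebra $A$ with identity and a locally nilpotent derivation $\delta$ of $A$ such that $$\operatorname{Coeff}C= A[t,t^{-1};\delta]\quad\text{and}\quad \operatorname{GKdim}A=\operatorname{GKdim}C .$$ If, moreover, $C$ is finitely generated (as a conformal algebra), then so is $A$ (as an algebra).
   Context: Everything is over $\mathbb{C}$. Conformal algebra: a $\mathbb{C}[\partial]$-module $C$ with $\mathbb{C}$-bilinear products $\circ_n$, $n\in\mathbb{Z}_{\ge 0}$, such that for all $a,b\in C$: (C1, locality) $a\circ_n b=0$ for all sufficiently large $n$; (C2) $\partial(a\circ_n b)=(\partial a)\circ_n b+a\circ_n(\partial b)$; (C3) $(\partial a)\circ_n b=-n\,a\circ_{n-1}b$ (so $(\partial a)\circ_0 b=0$). $C$ is finitely generated if it is generated by a finite set under $\partial$ and all the products. Coefficient algebra: on $\tilde C=C[t,t^{-1}]$ put $(at^l)\circ_0(bt^m)=\sum_{j\ge 0}\binom{l}{j}(a\circ_j b)\,t^{l+m-j}$. Then $\operatorname{Coeff}C=(\tilde C,\circ_0)/(\partial+\frac{d}{dt})\tilde C$. $C$ is called associative if $\operatorname{Coeff}C$ is an associative algebra; equivalently, $f\circ_m(g\circ_n h)=\sum_{j\ge 0}\binom{m}{j}(f\circ_j g)\circ_{m+n-j}h$ for all $f,g,h\in C$ and $m,n\ge 0$. Unital: there is $e\in C$ (a conformal identity) such that $e\circ_0 f=f$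 for all $f\in C$ and the locality degree of $e$ with itself is $1$, i.e. $e\circ_n e=0$ for all $n\ge 1$ while $e\circ_0 e\ne 0$. Left annihilator: $L(C)=\{f\in C: f\circ_n g=0\text{ for all }g\in C,\ n\ge 0\}$. Localized Ore extension: for an associative algebra $A$ with identity and a locally nilpotent derivation $\delta$ (for each $a\in A$ some power $\delta^k(a)=0$), $A[t,t^{-1};\delta]$ is the algebra of Laurent polynomials $\sum a_nt^n$ (a free left $A$-module with basis $t^n$, $n\in\mathbb{Z}$) with multiplication determined by $at-ta=\delta(a)$, i.e. $t^nb=\sum_{i\ge 0}(-1)^i\binom{n}{i}\delta^i(b)t^{n-i}$ for $n\in\mathbb{Z}$, $b\in A$. The equality with $\operatorname{Coeff}C$ is understood as an isomorphism of algebras. Gelfand–Kirillov dimension of a conformal algebra: if $C$ is generated by $f_1,\dots,f_k$, let $C_r$ be the $\mathbb{C}[\partial]$-span of all products of at most $r$ generators (any bracketing, any orders of multiplication). Then $\operatorname{GKdim}C=\limsup_{r\to\infty}\frac{\log \operatorname{rk}_{\mathbb{C}[\partial]}C_r}{\log r}$, independent of the generators; if $C$ is not finitely generated, $\operatorname{GKdim}C$ is the supremum over finitely generated conformal subalgebras. For ordinary algebras $\operatorname{GKdim}$ is the usual Gelfand–Kirillov dimension over $\mathbb{C}$. *)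

theory Defs
  imports
    Complex_Main
    "HOL-Library.Poly_Mapping"
    "HOL-Library.Extended_Real"
    "HOL-Library.Liminf_Limsup"
    "HOL-Computational_Algebra.Polynomial"
    "HOL-Algebra.Module"
    "HOL-Algebra.Subrings"
    "HOL-Algebra.Algebraic_Closure_Type"
begin

section \<open>Growth\<close>

text \<open>With Isabelle's convention ln 0 = 0, the zero module has growth 0. Only finitely many
  indices with ln r = 0 occur, so they do not influence the limit superior.\<close>

definition growth_exponent :: "(nat \<Rightarrow> nat) \<Rightarrow> ereal" where
  "growth_exponent d = limsup (\<lambda>r. ereal (ln (real (d r)) / ln (real r)))"


section \<open>Associative algebras over the complex numbers\<close>

text \<open>Algebras are records of the type of HOL-Algebra modules over the complex numbers. The
  library locale for algebras is restricted to commutative ones.\<close>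

definition unital_algebra :: "(complex, 'a) module \<Rightarrow> bool" where
  "unital_algebra A \<longleftrightarrow>
     ring A \<and> Module.module (ring_of_type_algebra :: complex ring) A \<and>
     (\<forall>c. \<forall>x\<in>carrier A. \<forall>y\<in>carrier A.
        (c \<odot>\<^bsub>A\<^esub> x) \<otimes>\<^bsub>A\<^esub> y = c \<odot>\<^bsub>A\<^esub> (x \<otimes>\<^bsub>A\<^esub> y) \<and>
        x \<otimes>\<^bsub>A\<^esub> (c \<odot>\<^bsub>A\<^esub> y) = c \<odot>\<^bsub>A\<^esub> (x \<otimes>\<^bsub>A\<^esub> y))"

text \<open>The field \<open>one\<close> is ignored, so that the notion also applies to algebras that are not
  known to have an identity.\<close>

definition algebra_iso ::
  "(complex, 'a) module \<Rightarrow> (complex, 'b) module \<Rightarrow> ('a \<Rightarrow> 'b) \<Rightarrow> bool" where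
  "algebra_iso A B \<phi> \<longleftrightarrow>
     bij_betw \<phi> (carrier A) (carrier B) \<and>
     (\<forall>x\<in>carrier A. \<forall>y\<in>carrier A.
        \<phi> (x \<oplus>\<^bsub>A\<^esub> y) = \<phi> x \<oplus>\<^bsub>B\<^esub> \<phi> y \<and> \<phi> (x \<otimes>\<^bsub>A\<^esub> y) = \<phi> x \<otimes>\<^bsub>B\<^esub> \<phi> y) \<and>
     (\<forall>c. \<forall>x\<in>carrier A. \<phi> (c \<odot>\<^bsub>A\<^esub> x) = c \<odot>\<^bsub>B\<^esub> \<phi> x)"

definition unital_subalgebra :: "(complex, 'a) module \<Rightarrow> 'a set \<Rightarrow> bool" where
  "unital_subalgebra A H \<longleftrightarrow> subring H A \<and> (\<forall>c. \<forall>x\<in>H. c \<odot>\<^bsub>A\<^esub> x \<in> H)"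

definition algebra_finitely_generated :: "(complex, 'a) module \<Rightarrow> bool" where
  "algebra_finitely_generated A \<longleftrightarrow>
     (\<exists>S. finite S \<and> S \<subseteq> carrier A \<and> unital_subalgebra A hull S = carrier A)"

definition algebra_span :: "(complex, 'a) module \<Rightarrow> 'a set \<Rightarrow> 'a set" where
  "algebra_span A S = {(\<Oplus>\<^bsub>A\<^esub>b\<in>B. c b \<odot>\<^bsub>A\<^esub> b) | B c. finite B \<and> B \<subseteq> S}"

definition algebra_independent :: "(complex, 'a) module \<Rightarrow> 'a set \<Rightarrow> bool" where
  "algebra_independent A B \<longleftrightarrow>
     (\<forall>c. (\<Oplus>\<^bsub>A\<^esub>b\<in>B. c b \<odot>\<^bsub>A\<^esub> b) = \<zero>\<^bsub>A\<^esub> \<longrightarrow> (\<forall>b\<in>B. c b = 0))"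

text \<open>The supremum is taken in the natural numbers; the notion is only meant for
  finite-dimensional subspaces.\<close>

definition algebra_dim :: "(complex, 'a) module \<Rightarrow> 'a set \<Rightarrow> nat" where
  "algebra_dim A V = Sup {card B | B. B \<subseteq> V \<and> finite B \<and> algebra_independent A B}"

definition algebra_words :: "(complex, 'a) module \<Rightarrow> 'a set \<Rightarrow> nat \<Rightarrow> 'a set" where
  "algebra_words A S r = {foldr (\<otimes>\<^bsub>A\<^esub>) ws \<one>\<^bsub>A\<^esub> | ws. set ws \<subseteq> S \<and> length ws \<le> r}"

text \<open>Finite-dimensional generating subspaces are given by finite spanning sets.\<close>

definition algebra_GKdim :: "(complex, 'a) module \<Rightarrow> ereal" where
  "algebra_GKdim A =
     (SUP S\<in>{S. finite S \<and> S \<subseteq> carrier A}.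
        growth_exponent (\<lambda>r. algebra_dim A (algebra_span A (algebra_words A S r))))"


section \<open>Localized Ore extensions\<close>

definition locally_nilpotent_derivation :: "(complex, 'a) module \<Rightarrow> ('a \<Rightarrow> 'a) \<Rightarrow> bool" where
  "locally_nilpotent_derivation A \<delta> \<longleftrightarrow>
     (\<forall>x\<in>carrier A. \<delta> x \<in> carrier A) \<and>
     (\<forall>x\<in>carrier A. \<forall>y\<in>carrier A.
        \<delta> (x \<oplus>\<^bsub>A\<^esub> y) = \<delta> x \<oplus>\<^bsub>A\<^esub> \<delta> y \<and>
        \<delta> (x \<otimes>\<^bsub>A\<^esub> y) = (\<delta> x \<otimes>\<^bsub>A\<^esub> y) \<oplus>\<^bsub>A\<^esub> (x \<otimes>\<^bsub>A\<^esub> \<delta> y)) \<and>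
     (\<forall>c. \<forall>x\<in>carrier A. \<delta> (c \<odot>\<^bsub>A\<^esub> x) = c \<odot>\<^bsub>A\<^esub> \<delta> x) \<and>
     (\<forall>x\<in>carrier A. \<exists>k. (\<delta> ^^ k) x = \<zero>\<^bsub>A\<^esub>)"

text \<open>A Laurent polynomial is its finitely supported coefficient function, coefficients standing to
  the left of the powers of \<open>t\<close>. The product is the biadditive extension of
  \<open>(a t^n) (b t^m) = (\<Sum>i. (-1)^i (n choose i) a \<delta>^i(b) t^(n+m-i))\<close>; in the coefficient of \<open>t^k\<close>
  the pair \<open>(n, m)\<close> contributes the term with \<open>i = n + m - k\<close>.\<close>

definition ore_Laurent ::
  "(complex, 'a) module \<Rightarrow> ('a \<Rightarrow> 'a) \<Rightarrow> (complex, int \<Rightarrow> 'a) module" where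
  "ore_Laurent A \<delta> =
     \<lparr>carrier = {f. (\<forall>n. f n \<in> carrier A) \<and> finite {n. f n \<noteq> \<zero>\<^bsub>A\<^esub>}},
      monoid.mult = (\<lambda>f g k.
        \<Oplus>\<^bsub>A\<^esub>n\<in>{n. f n \<noteq> \<zero>\<^bsub>A\<^esub>}. \<Oplus>\<^bsub>A\<^esub>m\<in>{m. g m \<noteq> \<zero>\<^bsub>A\<^esub> \<and> k \<le> n + m}.
          (let i = nat (n + m - k) in
             ((-1) ^ i * (of_int n gchoose i)) \<odot>\<^bsub>A\<^esub> (f n \<otimes>\<^bsub>A\<^esub> (\<delta> ^^ i) (g m)))),
      one = (\<lambda>n. if n = 0 then \<one>\<^bsub>A\<^esub> else \<zero>\<^bsub>A\<^esub>),
      zero = (\<lambda>n. \<zero>\<^bsub>A\<^esub>),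
      add = (\<lambda>f g n. f n \<oplus>\<^bsub>A\<^esub> g n),
      module.smult = (\<lambda>c f n. c \<odot>\<^bsub>A\<^esub> f n)\<rparr>"


section \<open>Conformal algebras\<close>

text \<open>The underlying \<open>\<complex>[\<partial>]\<close>-module is a whole type; \<open>scale p a\<close> is \<open>p(\<partial>) a\<close>, so \<open>\<partial>\<close> is the action
  of the polynomial indeterminate and complex scalars act as constant polynomials.\<close>

locale conformal_algebra = Modules.module scale
  for scale :: "complex poly \<Rightarrow> 'c::ab_group_add \<Rightarrow> 'c" (infixr \<open>*s\<close> 75) +
  fixes cprod :: "nat \<Rightarrow> 'c \<Rightarrow> 'c \<Rightarrow> 'c"
  assumes cprod_add_left: "cprod n (a + b) c = cprod n a c + cprod n b c"
    and cprod_add_right: "cprod n a (b + c) = cprod n a b + cprod n a c"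
    and cprod_scale_left: "cprod n ([:z:] *s a) b = [:z:] *s cprod n a b"
    and cprod_scale_right: "cprod n a ([:z:] *s b) = [:z:] *s cprod n a b"
    and locality: "\<exists>N. \<forall>n\<ge>N. cprod n a b = 0"
    and cprod_derivation:
      "[:0, 1:] *s cprod n a b = cprod n ([:0, 1:] *s a) b + cprod n a ([:0, 1:] *s b)"
    and cprod_sesquilinear:
      "cprod n ([:0, 1:] *s a) b = - (of_nat n *s cprod (n - 1) a b)"
begin

subsection \<open>The coefficient algebra\<close>

text \<open>An element of \<open>C[t, t\<^sup>-\<^sup>1]\<close> is a finitely supported function on the integers;
  \<open>Poly_Mapping.single n a\<close> is \<open>a t^n\<close>.\<close>

definition Laurent_prod :: "(int \<Rightarrow>\<^sub>0 'c) \<Rightarrow> (int \<Rightarrow>\<^sub>0 'c) \<Rightarrow> (int \<Rightarrow>\<^sub>0 'c)" where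
  "Laurent_prod F G =
     (\<Sum>l\<in>Poly_Mapping.keys F. \<Sum>m\<in>Poly_Mapping.keys G.
        Sum_any (\<lambda>j. Poly_Mapping.single (l + m - int j)
          ([:of_int l gchoose j:] *s cprod j (Poly_Mapping.lookup F l) (Poly_Mapping.lookup G m))))"

definition Laurent_scale :: "complex \<Rightarrow> (int \<Rightarrow>\<^sub>0 'c) \<Rightarrow> (int \<Rightarrow>\<^sub>0 'c)" where
  "Laurent_scale z F = Poly_Mapping.map (\<lambda>a. [:z:] *s a) F"

text \<open>The operator \<open>\<partial> + d/dt\<close>.\<close>

definition total_derivative :: "(int \<Rightarrow>\<^sub>0 'c) \<Rightarrow> (int \<Rightarrow>\<^sub>0 'c)" where
  "total_derivative F =
     (\<Sum>n\<in>Poly_Mapping.keys F.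
        Poly_Mapping.single n ([:0, 1:] *s Poly_Mapping.lookup F n) +
        Poly_Mapping.single (n - 1) (of_int n *s Poly_Mapping.lookup F n))"

definition coeff_rel :: "((int \<Rightarrow>\<^sub>0 'c) \<times> (int \<Rightarrow>\<^sub>0 'c)) set" where
  "coeff_rel = {(F, G). \<exists>H. F - G = total_derivative H}"

text \<open>The coefficient algebra of a general conformal algebra has no identity, so the field \<open>one\<close>
  carries no information.\<close>

definition Coeff :: "(complex, (int \<Rightarrow>\<^sub>0 'c) set) module" where
  "Coeff =
     \<lparr>carrier = UNIV // coeff_rel,
      monoid.mult = (\<lambda>U V. \<Union>F\<in>U. \<Union>G\<in>V. coeff_rel `` {Laurent_prod F G}),
      one = undefined,
      zero = coeff_rel `` {0},
      add = (\<lambda>U V. \<Union>F\<in>U. \<Union>G\<in>V. coeff_rel `` {F + G}),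
      module.smult = (\<lambda>z U. \<Union>F\<in>U. coeff_rel `` {Laurent_scale z F})\<rparr>"

definition conformal_associative :: bool where
  "conformal_associative \<longleftrightarrow>
     (\<forall>U\<in>carrier Coeff. \<forall>V\<in>carrier Coeff. \<forall>W\<in>carrier Coeff.
        (U \<otimes>\<^bsub>Coeff\<^esub> V) \<otimes>\<^bsub>Coeff\<^esub> W = U \<otimes>\<^bsub>Coeff\<^esub> (V \<otimes>\<^bsub>Coeff\<^esub> W))"


subsection \<open>Identity and annihilator\<close>

definition conformal_identity :: "'c \<Rightarrow> bool" where
  "conformal_identity e \<longleftrightarrow>
     (\<forall>f. cprod 0 e f = f) \<and> (\<forall>n\<ge>1. cprod n e e = 0) \<and> cprod 0 e e \<noteq> 0"

definition left_annihilator :: "'c set" where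
  "left_annihilator = {f. \<forall>g n. cprod n f g = 0}"


subsection \<open>Generators and Gelfand-Kirillov dimension\<close>

definition conformal_subalgebra :: "'c set \<Rightarrow> bool" where
  "conformal_subalgebra B \<longleftrightarrow> subspace B \<and> (\<forall>n. \<forall>a\<in>B. \<forall>b\<in>B. cprod n a b \<in> B)"

definition generates :: "'c set \<Rightarrow> bool" where
  "generates S \<longleftrightarrow> conformal_subalgebra hull S = UNIV"

definition conformal_finitely_generated :: bool where
  "conformal_finitely_generated \<longleftrightarrow> (\<exists>S. finite S \<and> generates S)"

text \<open>\<open>conformal_monomial S k w\<close>: \<open>w\<close> is a product of \<open>k\<close> elements of \<open>S\<close>.\<close>

inductive conformal_monomial :: "'c set \<Rightarrow> nat \<Rightarrow> 'c \<Rightarrow> bool" for S where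
  generator: "s \<in> S \<Longrightarrow> conformal_monomial S 1 s"
| product: "conformal_monomial S i u \<Longrightarrow> conformal_monomial S j v \<Longrightarrow>
    conformal_monomial S (i + j) (cprod n u v)"

definition filtration :: "'c set \<Rightarrow> nat \<Rightarrow> 'c set" where
  "filtration S r = span {w. \<exists>k\<le>r. conformal_monomial S k w}"

text \<open>The rank of a finitely generated \<open>\<complex>[\<partial>]\<close>-module: the maximal number of \<open>\<complex>[\<partial>]\<close>-linearly
  independent elements. For finite \<open>S\<close>, locality makes \<open>filtration S r\<close> finitely generated.\<close>

definition module_rank :: "'c set \<Rightarrow> nat" where
  "module_rank M = Sup {card B | B. B \<subseteq> M \<and> finite B \<and> independent B}"

definition conformal_growth :: "'c set \<Rightarrow> ereal" where
  "conformal_growth S = growth_exponent (\<lambda>r. module_rank (filtration S r))"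

text \<open>In the second case, \<open>conformal_growth S\<close> is the Gelfand-Kirillov dimension of the subalgebra
  generated by \<open>S\<close>.\<close>

definition conformal_GKdim :: ereal where
  "conformal_GKdim =
     (if conformal_finitely_generated
      then conformal_growth (SOME S. finite S \<and> generates S)
      else (SUP S\<in>{S. finite S}. conformal_growth S))"

end

end

theory Submission
  imports Defs
begin

text \<open>Write \<open>f(n)\<close> for the class of \<open>f t^n\<close> in the coefficient algebra. Since
  \<open>e(m) e(n) = e(m + n)\<close>, the element \<open>t = e(1)\<close> is invertible, and the aim is to write every
  element of the coefficient algebra uniquely as a polynomial in \<open>t\<close> and its inverse, with
  coefficients in a subalgebra that is stable under the commutator with \<open>t\<close>.

  The subalgebra comes from the set \<open>base\<close> of all \<open>f\<close> with \<open>f \<circ>_n e = 0\<close> for \<open>n > 0\<close>. Every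
  product \<open>f \<circ>_j e\<close> lies in it, and the triviality of the left annihilator gives the Taylor
  formula \<open>f = \<Sum>_j (-\<partial>)^j/j! (f \<circ>_j e)\<close> (\<open>expansion\<close>): the difference of the two sides
  annihilates everything from the left and therefore vanishes. Conversely, multiplying \<open>p(\<partial>) f\<close>
  with \<open>f\<close> in \<open>base\<close> by \<open>e\<close> reads off the coefficients of \<open>p\<close> (\<open>cprod_poly_e\<close>). Hence the
  algebra is the free \<open>\<complex>[\<partial>]\<close>-module over \<open>base\<close>.

  On \<open>base\<close> all products are determined by two operations, because \<open>f \<circ>_n g = f \<circ>_0 (e \<circ>_n g)\<close>
  and \<open>e \<circ>_m (e \<circ>_n f) = e \<circ>_(m+n) f\<close>: the product \<open>\<circ>_0\<close>, which is associative with identity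
  \<open>e\<close>, and the operator \<open>e \<circ>_1\<close>, whose \<open>n\<close>-th power is \<open>e \<circ>_n\<close> and which is therefore locally
  nilpotent by locality. Its negative is a derivation \<open>\<delta>\<close>, and \<open>f(0) t - t f(0) = (\<delta> f)(0)\<close>.
  With these formulas the product of two Laurent polynomials over \<open>base\<close> is literally the
  product in the Ore extension (\<open>ore_element_mult\<close>), and each class contains exactly one Laurent
  polynomial over \<open>base\<close> (\<open>bij_coeff_class_base_Laurent\<close>). All the identities between conformal
  products that are used here are extracted from associativity of the coefficient algebra, which
  is an identity for all powers of \<open>t\<close> at once (\<open>Laurent_tail_eq_zero\<close>,
  \<open>associativity_identity\<close>).

  For the growth, let \<open>S\<close> be a finite set. The elements \<open>e \<circ>_i (s \<circ>_j e)\<close> with \<open>s\<close> in \<open>S\<close> form a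
  finite subset \<open>T\<close> of \<open>base\<close> that is stable under all \<open>e \<circ>_n\<close>, and products of at most \<open>r\<close>
  elements of \<open>S\<close> lie in the \<open>\<complex>[\<partial>]\<close>-span of the words of length at most \<open>r\<close> in \<open>T\<close>
  (\<open>filtration_subset_span_words\<close>). Conversely, words of length at most \<open>r\<close> in a finite subset
  of \<open>base\<close> lie in the step \<open>2 q r\<close> of the filtration by a generating set, with \<open>q\<close> depending
  only on the two sets (\<open>words_subset_filtration\<close>). Elements of \<open>base\<close> that are independent over
  \<open>\<complex>\<close> are independent over \<open>\<complex>[\<partial>]\<close>, so that dimensions and ranks bound each other up to a linear
  change of \<open>r\<close>, which does not affect the growth exponent (\<open>growth_exponent_rescale\<close>).\<close>

section \<open>Laurent polynomials and the total derivative\<close>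

lemma poly_mapping_additive_induct [case_names zero single add]:
  fixes F :: "'a \<Rightarrow>\<^sub>0 'b::comm_monoid_add"
  assumes "P 0" "\<And>n a. P (Poly_Mapping.single n a)" "\<And>F G. P F \<Longrightarrow> P G \<Longrightarrow> P (F + G)"
  shows "P F"
proof -
  have "P (\<Sum>n\<in>K. Poly_Mapping.single n (Poly_Mapping.lookup F n))" if "finite K" for K
    using that by (induction K rule: finite_induct) (auto intro: assms)
  moreover have "F = (\<Sum>n\<in>Poly_Mapping.keys F. Poly_Mapping.single n (Poly_Mapping.lookup F n))"
    by (rule poly_mapping_eqI)
       (auto simp: lookup_sum lookup_single when_def in_keys_iff)
  ultimately show ?thesis by (metis finite_keys)
qed

context conformal_algebra
begin

text \<open>The constant polynomials make the underlying module a complex vector space. The prefix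
  distinguishes its notions of span, independence and dimension from those over \<open>\<complex>[\<partial>]\<close>.\<close>

sublocale cspace: vector_space "\<lambda>z a. [:z:] *s a"
  by unfold_locales (simp_all add: algebra_simps scale_right_distrib
      flip: scale_left_distrib one_pCons)

lemma of_nat_scale: "of_nat n *s a = [:of_nat n:] *s a"
  by (simp add: of_nat_poly)

lemma cprod_zero_left [simp]: "cprod n 0 b = 0"
  using cprod_add_left[of n 0 0 b] by simp

lemma cprod_zero_right [simp]: "cprod n a 0 = 0"
  using cprod_add_right[of n a 0 0] by simp

lemma cprod_uminus_left: "cprod n (- a) b = - cprod n a b"
  using cprod_add_left[of n a "-a" b] by (simp add: minus_unique)

lemma cprod_uminus_right: "cprod n a (- b) = - cprod n a b"
  using cprod_add_right[of n a b "-b"] by (simp add: minus_unique)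

lemma cprod_diff_left: "cprod n (a - a') b = cprod n a b - cprod n a' b"
  using cprod_add_left[of n a "-a'" b] by (simp add: cprod_uminus_left)

lemma cprod_sum_left: "cprod n (\<Sum>i\<in>I. f i) b = (\<Sum>i\<in>I. cprod n (f i) b)"
  by (induction I rule: infinite_finite_induct) (simp_all add: cprod_add_left)

lemma total_derivative_lookup:
  "Poly_Mapping.lookup (total_derivative F) n =
     [:0, 1:] *s Poly_Mapping.lookup F n + [:of_int (n + 1):] *s Poly_Mapping.lookup F (n + 1)"
proof -
  have "Poly_Mapping.lookup (total_derivative F) n =
    (\<Sum>k\<in>Poly_Mapping.keys F. (if k = n then [:0, 1:] *s Poly_Mapping.lookup F k else 0)
       + (if k = n + 1 then of_int k *s Poly_Mapping.lookup F k else 0))"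
    unfolding total_derivative_def lookup_sum
    by (rule sum.cong) (auto simp: lookup_add lookup_single when_def)
  also have "\<dots> = [:0, 1:] *s Poly_Mapping.lookup F n + of_int (n + 1) *s Poly_Mapping.lookup F (n + 1)"
    by (auto simp: sum.distrib in_keys_iff)
  finally show ?thesis by (simp add: of_int_poly)
qed

lemma total_derivative_add: "total_derivative (F + G) = total_derivative F + total_derivative G"
  by (rule poly_mapping_eqI)
     (simp add: total_derivative_lookup lookup_add scale_right_distrib algebra_simps)

lemma total_derivative_zero [simp]: "total_derivative 0 = 0"
  using total_derivative_add[of 0 0] by simp

lemma total_derivative_uminus: "total_derivative (- F) = - total_derivative F"
  using total_derivative_add[of F "- F"] by (simp add: minus_unique)

lemma Laurent_scale_lookup [simp]:
  "Poly_Mapping.lookup (Laurent_scale z F) n = [:z:] *s Poly_Mapping.lookup F n"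
  by (simp add: Laurent_scale_def map.rep_eq when_def)

lemma Laurent_scale_add: "Laurent_scale z (F + G) = Laurent_scale z F + Laurent_scale z G"
  by (rule poly_mapping_eqI) (simp add: lookup_add scale_right_distrib)

lemma total_derivative_scale:
  "total_derivative (Laurent_scale z F) = Laurent_scale z (total_derivative F)"
  by (rule poly_mapping_eqI)
     (simp add: total_derivative_lookup scale_right_distrib mult.commute)

definition monomial_prod :: "int \<Rightarrow> 'c \<Rightarrow> int \<Rightarrow> 'c \<Rightarrow> (int \<Rightarrow>\<^sub>0 'c)" where
  "monomial_prod l a m b =
     Sum_any (\<lambda>j. Poly_Mapping.single (l + m - int j) ([:of_int l gchoose j:] *s cprod j a b))"

text \<open>The coefficient of \<open>t^k\<close> in the product of \<open>a t^l\<close> and \<open>b t^m\<close>.\<close>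

definition monomial_prod_coeff :: "int \<Rightarrow> 'c \<Rightarrow> int \<Rightarrow> 'c \<Rightarrow> int \<Rightarrow> 'c" where
  "monomial_prod_coeff l a m b k = (if k \<le> l + m
     then [:of_int l gchoose nat (l + m - k):] *s cprod (nat (l + m - k)) a b else 0)"

lemma lookup_monomial_prod:
  "Poly_Mapping.lookup (monomial_prod l a m b) k = monomial_prod_coeff l a m b k"
proof -
  obtain N where N: "\<And>n. n \<ge> N \<Longrightarrow> cprod n a b = 0" using locality by blast
  have "monomial_prod l a m b =
      (\<Sum>j<N. Poly_Mapping.single (l + m - int j) ([:of_int l gchoose j:] *s cprod j a b))"
    unfolding monomial_prod_def
    by (rule Sum_any.expand_superset) (auto, metis N leI scale_zero_right single_zero)
  also have "Poly_Mapping.lookup \<dots> k =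
      (\<Sum>j<N. if j = nat (l + m - k) then monomial_prod_coeff l a m b k else 0)"
    unfolding lookup_sum by (rule sum.cong) (auto simp: lookup_single when_def monomial_prod_coeff_def)
  also have "\<dots> = monomial_prod_coeff l a m b k"
    using N by (auto simp: monomial_prod_coeff_def)
  finally show ?thesis .
qed

lemma monomial_prod_add_left:
  "monomial_prod l (a + a') m b = monomial_prod l a m b + monomial_prod l a' m b"
  by (rule poly_mapping_eqI)
     (simp add: lookup_add lookup_monomial_prod monomial_prod_coeff_def cprod_add_left scale_right_distrib)

lemma monomial_prod_add_right:
  "monomial_prod l a m (b + b') = monomial_prod l a m b + monomial_prod l a m b'"
  by (rule poly_mapping_eqI)
     (simp add: lookup_add lookup_monomial_prod monomial_prod_coeff_def cprod_add_right scale_right_distrib)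

lemma monomial_prod_zero [simp]:
  "monomial_prod l 0 m b = 0" "monomial_prod l a m 0 = 0"
  by (simp_all add: monomial_prod_def)

text \<open>Summing over arbitrary finite sets that contain the supports makes additivity of the
  product visible.\<close>

lemma Laurent_prod_superset:
  assumes "finite K" "finite K'" "Poly_Mapping.keys F \<subseteq> K" "Poly_Mapping.keys G \<subseteq> K'"
  shows "Laurent_prod F G =
    (\<Sum>l\<in>K. \<Sum>m\<in>K'. monomial_prod l (Poly_Mapping.lookup F l) m (Poly_Mapping.lookup G m))"
proof -
  have "Laurent_prod F G = (\<Sum>l\<in>Poly_Mapping.keys F. \<Sum>m\<in>Poly_Mapping.keys G.
        monomial_prod l (Poly_Mapping.lookup F l) m (Poly_Mapping.lookup G m))"
    by (simp add: Laurent_prod_def monomial_prod_def)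
  also have "\<dots> = (\<Sum>l\<in>Poly_Mapping.keys F. \<Sum>m\<in>K'.
        monomial_prod l (Poly_Mapping.lookup F l) m (Poly_Mapping.lookup G m))"
    using assms by (intro sum.cong refl sum.mono_neutral_left) (auto simp: in_keys_iff)
  also have "\<dots> = (\<Sum>l\<in>K. \<Sum>m\<in>K'.
        monomial_prod l (Poly_Mapping.lookup F l) m (Poly_Mapping.lookup G m))"
    using assms by (intro sum.mono_neutral_left) (auto simp: in_keys_iff)
  finally show ?thesis .
qed

lemma Laurent_prod_add_left: "Laurent_prod (F + F') G = Laurent_prod F G + Laurent_prod F' G"
proof -
  define K where "K = Poly_Mapping.keys F \<union> Poly_Mapping.keys F' \<union> Poly_Mapping.keys (F + F')"
  have K: "finite K" "Poly_Mapping.keys F \<subseteq> K" "Poly_Mapping.keys F' \<subseteq> K" "Poly_Mapping.keys (F + F') \<subseteq> K"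
    by (auto simp: K_def)
  show ?thesis
    by (simp add: Laurent_prod_superset[OF K(1) finite_keys _ order_refl] K
        lookup_add monomial_prod_add_left sum.distrib)
qed

lemma Laurent_prod_add_right: "Laurent_prod F (G + G') = Laurent_prod F G + Laurent_prod F G'"
proof -
  define K where "K = Poly_Mapping.keys G \<union> Poly_Mapping.keys G' \<union> Poly_Mapping.keys (G + G')"
  have K: "finite K" "Poly_Mapping.keys G \<subseteq> K" "Poly_Mapping.keys G' \<subseteq> K" "Poly_Mapping.keys (G + G') \<subseteq> K"
    by (auto simp: K_def)
  show ?thesis
    by (simp add: Laurent_prod_superset[OF finite_keys K(1) order_refl] K
        lookup_add monomial_prod_add_right sum.distrib)
qed

lemma Laurent_prod_zero [simp]: "Laurent_prod 0 G = 0" "Laurent_prod F 0 = 0"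
  by (simp_all add: Laurent_prod_def)

lemma Laurent_prod_single:
  "Laurent_prod (Poly_Mapping.single l a) (Poly_Mapping.single m b) = monomial_prod l a m b"
  by (subst Laurent_prod_superset[of "{l}" "{m}"]) auto

lemma total_derivative_single:
  "total_derivative (Poly_Mapping.single n a) =
     Poly_Mapping.single n ([:0, 1:] *s a) + Poly_Mapping.single (n - 1) ([:of_int n:] *s a)"
  by (rule poly_mapping_eqI)
     (auto simp: total_derivative_lookup lookup_add lookup_single when_def)

text \<open>The two terms \<open>\<partial>a t^l\<close> and \<open>l a t^(l-1)\<close> of a total derivative contribute opposite amounts
  to the product, since \<open>(\<partial>a) \<circ>_j b = - j a \<circ>_(j-1) b\<close> and
  \<open>j (l choose j) = l (l-1 choose j-1)\<close>. So total derivatives annihilate everything from the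
  left.\<close>

lemma Laurent_prod_total_derivative_left: "Laurent_prod (total_derivative F) G = 0"
proof (induction F rule: poly_mapping_additive_induct)
  case (single l a)
  show ?case
  proof (induction G rule: poly_mapping_additive_induct)
    case (single m b)
    have "monomial_prod_coeff l ([:0, 1:] *s a) m b k + monomial_prod_coeff (l - 1) ([:of_int l:] *s a) m b k = 0" for k
    proof (cases "k < l + m")
      case True
      define i where "i = nat (l + m - k) - 1"
      have i: "nat (l + m - k) = Suc i" "nat (l - 1 + m - k) = i" using True by (auto simp: i_def)
      have "of_nat (Suc i) * (of_int l gchoose Suc i) =
          (of_int l * (of_int (l - 1) gchoose i) :: complex)"
        using gbinomial_absorption[of i "of_int l :: complex"] by simp
      then show ?thesis
        using True i by (simp add: monomial_prod_coeff_def cprod_sesquilinear cprod_scale_left of_nat_poly mult.commute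
            del: of_nat_Suc)
    next
      case False
      then show ?thesis by (auto simp: monomial_prod_coeff_def cprod_sesquilinear)
    qed
    then show ?case
      by (intro poly_mapping_eqI) (simp add: total_derivative_single Laurent_prod_add_left
          Laurent_prod_single lookup_add lookup_monomial_prod)
  qed (simp_all add: Laurent_prod_add_right)
qed (simp_all add: total_derivative_add Laurent_prod_add_left)

text \<open>Both \<open>\<partial>\<close> and \<open>d/dt\<close> are derivations. For the second, the coefficients match by
  \<open>l (l-1 choose j) = (l-j) (l choose j)\<close>. With the previous lemma this makes the total
  derivatives a two-sided ideal.\<close>

lemma total_derivative_Laurent_prod:
  "total_derivative (Laurent_prod F G) =
     Laurent_prod (total_derivative F) G + Laurent_prod F (total_derivative G)"
proof (induction F rule: poly_mapping_additive_induct)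
  case (single l a)
  show ?case
  proof (induction G rule: poly_mapping_additive_induct)
    case (single m b)
    have "[:0, 1:] *s monomial_prod_coeff l a m b k + [:of_int (k + 1):] *s monomial_prod_coeff l a m b (k + 1) =
        monomial_prod_coeff l a m ([:0, 1:] *s b) k + monomial_prod_coeff l a (m - 1) ([:of_int m:] *s b) k" for k
    proof (cases "k < l + m")
      case True
      define i where "i = nat (l + m - k) - 1"
      have i: "nat (l + m - k) = Suc i" "nat (l - 1 + m - k) = i" "nat (l + (m - 1) - k) = i"
        "nat (l + m - (k + 1)) = i" "k = l + m - int (Suc i)"
        using True by (auto simp: i_def)
      have *: "of_nat (Suc i) * (of_int l gchoose Suc i) =
          (of_int l * (of_int (l - 1) gchoose i) :: complex)"
        using gbinomial_absorption[of i "of_int l :: complex"] by simp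
      have **: "(of_int l - of_nat i) * (of_int l gchoose i) =
          (of_int l * (of_int (l - 1) gchoose i) :: complex)"
        using gbinomial_absorb_comp[of "of_int l :: complex" i] by simp
      have 1: "[:0, 1:] *s [:of_int l gchoose Suc i:] *s cprod (Suc i) a b =
          [:of_int l gchoose Suc i:] *s cprod (Suc i) a ([:0, 1:] *s b)
          + [:- (of_int l * (of_int (l - 1) gchoose i)):] *s cprod i a b"
      proof -
        have "[:0, 1:] *s [:of_int l gchoose Suc i:] *s cprod (Suc i) a b =
          [:of_int l gchoose Suc i:] *s ([:0, 1:] *s cprod (Suc i) a b)"
          by (simp add: scale_left_commute)
        also have "\<dots> = [:of_int l gchoose Suc i:] *s cprod (Suc i) a ([:0, 1:] *s b)
          + [:- (of_nat (Suc i) * (of_int l gchoose Suc i)):] *s cprod i a b"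
          unfolding cprod_derivation cprod_sesquilinear of_nat_scale
          by (simp add: scale_right_distrib scale_right_diff_distrib mult.commute del: of_nat_Suc)
        finally show ?thesis unfolding * .
      qed
      have "of_int (k + 1) * (of_int l gchoose i) - of_int l * (of_int (l - 1) gchoose i)
          = (of_int m * (of_int l gchoose i) :: complex)"
        unfolding **[symmetric] i(5) by (simp add: algebra_simps)
      then have 2: "[:- (of_int l * (of_int (l - 1) gchoose i)):] *s cprod i a b
          + [:of_int (k + 1):] *s [:of_int l gchoose i:] *s cprod i a b
          = [:of_int m * (of_int l gchoose i):] *s cprod i a b"
        by (metis (no_types, lifting) ab_group_add_class.ab_diff_conv_add_uminus add.commute cspace.scale_left_distrib cspace.scale_scale)
      show ?thesis
        unfolding monomial_prod_coeff_def i(1-4) using True 1 2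
        by (simp add: cprod_scale_right add.assoc mult.commute)
    next
      case False
      then show ?thesis
        by (auto simp: monomial_prod_coeff_def cprod_derivation cprod_sesquilinear)
    qed
    then show ?case unfolding Laurent_prod_total_derivative_left
      by (intro poly_mapping_eqI) (simp add: total_derivative_single Laurent_prod_add_right
          Laurent_prod_single lookup_add lookup_monomial_prod total_derivative_lookup)
  qed (simp_all add: Laurent_prod_add_right total_derivative_add)
qed (simp_all add: total_derivative_add Laurent_prod_add_left)

section \<open>The coefficient algebra\<close>

definition coeff_class :: "(int \<Rightarrow>\<^sub>0 'c) \<Rightarrow> (int \<Rightarrow>\<^sub>0 'c) set" where
  "coeff_class F = coeff_rel `` {F}"

lemma mem_coeff_class: "G \<in> coeff_class F \<longleftrightarrow> (\<exists>H. F - G = total_derivative H)"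
  by (simp add: coeff_class_def coeff_rel_def)

lemma equiv_coeff_rel: "equiv UNIV coeff_rel"
proof (rule equivI)
  show "refl coeff_rel"
    by (auto simp: refl_on_def coeff_rel_def intro!: exI[of _ 0])
  show "sym coeff_rel"
  proof (rule symI, unfold coeff_rel_def, clarsimp)
    fix F G H assume "F - G = total_derivative H"
    then have "G - F = total_derivative (- H)"
      by (metis minus_diff_eq total_derivative_uminus)
    then show "\<exists>H. G - F = total_derivative H" by blast
  qed
  show "trans coeff_rel"
  proof (rule transI, unfold coeff_rel_def, clarsimp)
    fix F G K H H' assume "F - G = total_derivative H" "G - K = total_derivative H'"
    then have "F - K = total_derivative (H + H')"
      by (metis diff_add_cancel diff_diff_eq2 add_diff_eq total_derivative_add)
    then show "\<exists>H. F - K = total_derivative H" by blast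
  qed
qed auto

lemma coeff_class_eq_iff: "coeff_class F = coeff_class G \<longleftrightarrow> (\<exists>H. F - G = total_derivative H)"
  using eq_equiv_class_iff[OF equiv_coeff_rel, of F G] by (simp add: coeff_class_def) (simp add: coeff_rel_def)

lemma carrier_Coeff: "carrier Coeff = range coeff_class"
  by (auto simp: Coeff_def quotient_def coeff_class_def)

lemma coeff_class_in_carrier [simp]: "coeff_class F \<in> carrier Coeff"
  by (simp add: carrier_Coeff)

lemma coeff_class_self: "F \<in> coeff_class F"
  unfolding mem_coeff_class by (rule exI[of _ 0]) simp

lemma Coeff_zero: "\<zero>\<^bsub>Coeff\<^esub> = coeff_class 0"
  by (simp add: Coeff_def coeff_class_def)

lemma Coeff_add: "coeff_class F \<oplus>\<^bsub>Coeff\<^esub> coeff_class G = coeff_class (F + G)"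
proof -
  have "coeff_class (F' + G') = coeff_class (F + G)" if FG: "F' \<in> coeff_class F" "G' \<in> coeff_class G" for F' G'
  proof -
    from FG obtain H K where "F - F' = total_derivative H" "G - G' = total_derivative K"
      unfolding mem_coeff_class by blast
    then have "(F + G) - (F' + G') = total_derivative (H + K)"
      by (simp add: total_derivative_add flip: \<open>F - F' = _\<close>)
    then show ?thesis using coeff_class_eq_iff by metis
  qed
  then have "(\<Union>F'\<in>coeff_class F. \<Union>G'\<in>coeff_class G. coeff_class (F' + G')) = coeff_class (F + G)"
    using coeff_class_self by blast
  then show ?thesis by (simp add: Coeff_def coeff_class_def)
qed

lemma Coeff_smult: "z \<odot>\<^bsub>Coeff\<^esub> coeff_class F = coeff_class (Laurent_scale z F)"
proof -
  have "coeff_class (Laurent_scale z F') = coeff_class (Laurent_scale z F)" if F: "F' \<in> coeff_class F" for F'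
  proof -
    from F obtain H where "F - F' = total_derivative H" unfolding mem_coeff_class by blast
    then have "Laurent_scale z F - Laurent_scale z F' = total_derivative (Laurent_scale z H)"
      by (metis total_derivative_scale Laurent_scale_add add_diff_cancel_right' diff_add_cancel)
    then show ?thesis using coeff_class_eq_iff by metis
  qed
  then have "(\<Union>F'\<in>coeff_class F. coeff_class (Laurent_scale z F')) = coeff_class (Laurent_scale z F)"
    using coeff_class_self by blast
  then show ?thesis by (simp add: Coeff_def coeff_class_def)
qed

lemma Coeff_mult: "coeff_class F \<otimes>\<^bsub>Coeff\<^esub> coeff_class G = coeff_class (Laurent_prod F G)"
proof -
  have "coeff_class (Laurent_prod F' G') = coeff_class (Laurent_prod F G)" if FG: "F' \<in> coeff_class F" "G' \<in> coeff_class G" for F' G'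
  proof -
    from FG obtain H K where HK: "F = F' + total_derivative H" "G = G' + total_derivative K"
      unfolding mem_coeff_class by (metis diff_add_cancel add.commute)
    have "Laurent_prod F G - Laurent_prod F' G' = total_derivative (Laurent_prod F' K)"
      unfolding HK total_derivative_Laurent_prod
      by (simp add: Laurent_prod_add_left Laurent_prod_add_right Laurent_prod_total_derivative_left)
    then show ?thesis using coeff_class_eq_iff by metis
  qed
  then have "(\<Union>F'\<in>coeff_class F. \<Union>G'\<in>coeff_class G. coeff_class (Laurent_prod F' G')) = coeff_class (Laurent_prod F G)"
    using coeff_class_self by blast
  then show ?thesis by (simp add: Coeff_def coeff_class_def)
qed

text \<open>The coefficient of \<open>t^n\<close> in a total derivative determines \<open>(n+1) H_(n+1)\<close> from \<open>H_n\<close>.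
  Starting far to the left, where \<open>H\<close> vanishes, one gets \<open>H_n = 0\<close> up to \<open>n = -1\<close>; the recursion
  breaks down at the next step because the factor \<open>n + 1\<close> is then \<open>0\<close>.\<close>

lemma total_derivative_primitive_vanishes:
  assumes "\<And>n. n < -1 \<Longrightarrow> Poly_Mapping.lookup (total_derivative H) n = 0" "n < 0"
  shows "Poly_Mapping.lookup H n = 0"
proof -
  obtain M where M: "\<And>n. n \<le> M \<Longrightarrow> Poly_Mapping.lookup H n = 0"
  proof -
    have "finite (Poly_Mapping.keys H)" by simp
    then have "bdd_below (Poly_Mapping.keys H)" by (rule bdd_below_finite)
    then obtain m where "\<And>n. n \<in> Poly_Mapping.keys H \<Longrightarrow> m \<le> n" by (auto simp: bdd_below_def)
    then have "Poly_Mapping.lookup H n = 0" if "n \<le> m - 1" for n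
      using that by (force simp: in_keys_iff)
    then show thesis using that by blast
  qed
  show ?thesis
  proof (cases "n \<le> M")
    case False
    then have "M \<le> n" by simp
    then show ?thesis using \<open>n < 0\<close>
    proof (induction n rule: int_ge_induct)
      case base then show ?case by (simp add: M)
    next
      case (step i)
      have "[:of_int (i + 1):] *s Poly_Mapping.lookup H (i + 1) = 0"
        using assms(1)[of i] step by (simp add: total_derivative_lookup)
      then show ?case using step.prems
        by (metis cspace.scale_eq_0_iff of_int_eq_0_iff less_irrefl)
    qed
  qed (simp add: M)
qed

text \<open>This turns identities in the coefficient algebra into identities between conformal
  products. A single class determines little, but if \<open>\<Sum>_i Z_i t^(p-i)\<close> is a total derivative for
  every \<open>p\<close>, then all \<open>Z_i\<close> vanish.\<close>

lemma Laurent_tail_eq_zero: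
  fixes Z :: "nat \<Rightarrow> 'c"
  assumes exact: "\<And>p. \<exists>H. total_derivative H = F p"
    and F: "\<And>p k. Poly_Mapping.lookup (F p) k = (if k \<le> p then Z (nat (p - k)) else 0)"
  shows "Z s = 0"
proof (rule ccontr)
  assume "Z s \<noteq> 0"
  have "finite {i. Z i \<noteq> 0}"
  proof (rule finite_subset)
    show "{i. Z i \<noteq> 0} \<subseteq> (\<lambda>k. nat (- k)) ` Poly_Mapping.keys (F 0)"
    proof
      fix i assume "i \<in> {i. Z i \<noteq> 0}"
      then have "- int i \<in> Poly_Mapping.keys (F 0)" by (simp add: in_keys_iff F)
      then show "i \<in> (\<lambda>k. nat (- k)) ` Poly_Mapping.keys (F 0)" by force
    qed
  qed auto
  define S where "S = Max {i. Z i \<noteq> 0}"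
  have S: "Z S \<noteq> 0"
    using Max_in[of "{i. Z i \<noteq> 0}"] \<open>Z s \<noteq> 0\<close> \<open>finite _\<close> unfolding S_def by blast
  have S_max: "Z i = 0" if "S < i" for i
    using Max_ge[of "{i. Z i \<noteq> 0}" i] that \<open>finite _\<close> unfolding S_def by (metis leD mem_Collect_eq)
  \<comment> \<open>With \<open>p = S - 1\<close> the lowest term is \<open>Z_S t^(-1)\<close>, and \<open>d/dt\<close> never produces
    \<open>t^(-1)\<close>.\<close>
  obtain H where H: "total_derivative H = F (int S - 1)" using exact by blast
  have "Poly_Mapping.lookup H (-1) = 0"
    by (rule total_derivative_primitive_vanishes) (simp_all add: H F S_max nat_less_eq_zless)
  then have "Poly_Mapping.lookup (F (int S - 1)) (-1) = 0"
    unfolding H[symmetric] total_derivative_lookup by simp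
  then show False using S by (simp add: F)
qed

lemma Laurent_prod_sum_left:
  "finite I \<Longrightarrow> Laurent_prod (\<Sum>i\<in>I. F i) G = (\<Sum>i\<in>I. Laurent_prod (F i) G)"
  by (induction I rule: finite_induct) (simp_all add: Laurent_prod_add_left)

lemma Laurent_prod_sum_right:
  "finite I \<Longrightarrow> Laurent_prod F (\<Sum>i\<in>I. G i) = (\<Sum>i\<in>I. Laurent_prod F (G i))"
  by (induction I rule: finite_induct) (simp_all add: Laurent_prod_add_right)

lemma monomial_prod_eq_sum:
  assumes "\<And>j. j \<ge> N \<Longrightarrow> cprod j a b = 0"
  shows "monomial_prod l a m b =
      (\<Sum>j<N. Poly_Mapping.single (l + m - int j) ([:of_int l gchoose j:] *s cprod j a b))"
  unfolding monomial_prod_def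
  by (rule Sum_any.expand_superset) (auto, metis assms leI scale_zero_right single_zero)

lemma cscale_mult: "[:x:] *s [:y:] *s a = [:x * y:] *s a"
  by (rule cspace.scale_scale)

section \<open>Associativity in terms of the conformal products\<close>

text \<open>In both triple products the sum is indexed by the order \<open>j\<close> of the product with \<open>f\<close>; the
  exponent \<open>k\<close> then determines the other order.\<close>

lemma lookup_Laurent_prod_assoc_left:
  "Poly_Mapping.lookup (Laurent_prod (Laurent_prod (Poly_Mapping.single l f) (Poly_Mapping.single m g))
       (Poly_Mapping.single n h)) k =
   (if k \<le> l + m + n then
      \<Sum>j\<le>nat (l + m + n - k). [:(of_int l gchoose j) * (of_int (l + m - int j) gchoose (nat (l + m + n - k) - j)):] *s
         cprod (nat (l + m + n - k) - j) (cprod j f g) h else 0)"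
proof -
  obtain N where N: "\<And>j. j \<ge> N \<Longrightarrow> cprod j f g = 0" using locality by blast
  have "Poly_Mapping.lookup (Laurent_prod (Laurent_prod (Poly_Mapping.single l f) (Poly_Mapping.single m g))
       (Poly_Mapping.single n h)) k =
    (\<Sum>j<N. monomial_prod_coeff (l + m - int j) ([:of_int l gchoose j:] *s cprod j f g) n h k)"
    by (simp add: Laurent_prod_single monomial_prod_eq_sum[OF N] Laurent_prod_sum_left
        lookup_sum lookup_monomial_prod)
  also have "\<dots> = (if k \<le> l + m + n then
      \<Sum>j\<le>nat (l + m + n - k). [:(of_int l gchoose j) * (of_int (l + m - int j) gchoose (nat (l + m + n - k) - j)):] *s
         cprod (nat (l + m + n - k) - j) (cprod j f g) h else 0)"
  proof (cases "k \<le> l + m + n")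
    case True
    define s where "s = nat (l + m + n - k)"
    have "(\<Sum>j<N. monomial_prod_coeff (l + m - int j) ([:of_int l gchoose j:] *s cprod j f g) n h k) =
      (\<Sum>j\<in>{..<N} \<union> {..s}. monomial_prod_coeff (l + m - int j) ([:of_int l gchoose j:] *s cprod j f g) n h k)"
      by (rule sum.mono_neutral_left) (auto simp: monomial_prod_coeff_def N)
    also have "\<dots> = (\<Sum>j\<le>s. monomial_prod_coeff (l + m - int j) ([:of_int l gchoose j:] *s cprod j f g) n h k)"
      using True by (intro sum.mono_neutral_right) (auto simp: monomial_prod_coeff_def s_def)
    also have "\<dots> = (\<Sum>j\<le>s. [:(of_int l gchoose j) * (of_int (l + m - int j) gchoose (s - j)):] *s
         cprod (s - j) (cprod j f g) h)"
    proof (rule sum.cong)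
      fix j assume "j \<in> {..s}"
      then have "k \<le> l + m - int j + n" "nat (l + m - int j + n - k) = s - j"
        using True by (auto simp: s_def)
      then show "monomial_prod_coeff (l + m - int j) ([:of_int l gchoose j:] *s cprod j f g) n h k =
        [:(of_int l gchoose j) * (of_int (l + m - int j) gchoose (s - j)):] *s
         cprod (s - j) (cprod j f g) h"
        by (simp add: monomial_prod_coeff_def cprod_scale_left mult.commute)
    qed auto
    finally show ?thesis using True by (simp add: s_def)
  next
    case False
    then show ?thesis by (auto simp: monomial_prod_coeff_def intro!: sum.neutral)
  qed
  finally show ?thesis .
qed

lemma lookup_Laurent_prod_assoc_right:
  "Poly_Mapping.lookup (Laurent_prod (Poly_Mapping.single l f)
       (Laurent_prod (Poly_Mapping.single m g) (Poly_Mapping.single n h))) k =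
   (if k \<le> l + m + n then
      \<Sum>j\<le>nat (l + m + n - k). [:(of_int l gchoose j) * (of_int m gchoose (nat (l + m + n - k) - j)):] *s
         cprod j f (cprod (nat (l + m + n - k) - j) g h) else 0)"
proof -
  obtain N where N: "\<And>j. j \<ge> N \<Longrightarrow> cprod j g h = 0" using locality by blast
  have "Poly_Mapping.lookup (Laurent_prod (Poly_Mapping.single l f)
       (Laurent_prod (Poly_Mapping.single m g) (Poly_Mapping.single n h))) k =
    (\<Sum>i<N. monomial_prod_coeff l f (m + n - int i) ([:of_int m gchoose i:] *s cprod i g h) k)"
    by (simp add: Laurent_prod_single monomial_prod_eq_sum[OF N] Laurent_prod_sum_right
        lookup_sum lookup_monomial_prod)
  also have "\<dots> = (if k \<le> l + m + n then
      \<Sum>j\<le>nat (l + m + n - k). [:(of_int l gchoose j) * (of_int m gchoose (nat (l + m + n - k) - j)):] *s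
         cprod j f (cprod (nat (l + m + n - k) - j) g h) else 0)"
  proof (cases "k \<le> l + m + n")
    case True
    define s where "s = nat (l + m + n - k)"
    have "(\<Sum>i<N. monomial_prod_coeff l f (m + n - int i) ([:of_int m gchoose i:] *s cprod i g h) k) =
      (\<Sum>i\<in>{..<N} \<union> {..s}. monomial_prod_coeff l f (m + n - int i) ([:of_int m gchoose i:] *s cprod i g h) k)"
      by (rule sum.mono_neutral_left) (auto simp: monomial_prod_coeff_def N)
    also have "\<dots> = (\<Sum>i\<le>s. monomial_prod_coeff l f (m + n - int i) ([:of_int m gchoose i:] *s cprod i g h) k)"
      using True by (intro sum.mono_neutral_right) (auto simp: monomial_prod_coeff_def s_def)
    also have "\<dots> = (\<Sum>j\<le>s. monomial_prod_coeff l f (m + n - int (s - j)) ([:of_int m gchoose (s - j):] *s cprod (s - j) g h) k)"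
      by (rule sum.nat_diff_reindex[of _ "Suc s", unfolded lessThan_Suc_atMost, simplified, symmetric])
    also have "\<dots> = (\<Sum>j\<le>s. [:(of_int l gchoose j) * (of_int m gchoose (s - j)):] *s
         cprod j f (cprod (s - j) g h))"
    proof (rule sum.cong)
      fix j assume "j \<in> {..s}"
      then have "k \<le> l + (m + n - int (s - j))" "nat (l + (m + n - int (s - j)) - k) = j"
        using True by (auto simp: s_def)
      then show "monomial_prod_coeff l f (m + n - int (s - j)) ([:of_int m gchoose (s - j):] *s cprod (s - j) g h) k =
        [:(of_int l gchoose j) * (of_int m gchoose (s - j)):] *s cprod j f (cprod (s - j) g h)"
        by (simp add: monomial_prod_coeff_def cprod_scale_right mult.commute)
    qed auto
    finally show ?thesis using True by (simp add: s_def)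
  next
    case False
    then show ?thesis by (auto simp: monomial_prod_coeff_def intro!: sum.neutral)
  qed
  finally show ?thesis .
qed

text \<open>Compare the coefficients of \<open>(f t^l \<cdot> g t^m) \<cdot> h t^n\<close> and \<open>f t^l \<cdot> (g t^m \<cdot> h t^n)\<close> for
  fixed \<open>l\<close>, \<open>m\<close> and all \<open>n\<close>. The exponents \<open>l\<close> and \<open>m\<close> may be negative, which is exploited
  below.\<close>

lemma associativity_identity:
  assumes conformal_associative
  shows "(\<Sum>j\<le>s. [:(of_int l gchoose j) * (of_int (l + m - int j) gchoose (s - j)):] *s
            cprod (s - j) (cprod j f g) h) =
         (\<Sum>j\<le>s. [:(of_int l gchoose j) * (of_int m gchoose (s - j)):] *s
            cprod j f (cprod (s - j) g h))"
    (is "?X s = ?Y s")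
proof -
  define F where "F p = Laurent_prod (Laurent_prod (Poly_Mapping.single l f) (Poly_Mapping.single m g))
      (Poly_Mapping.single (p - l - m) h) - Laurent_prod (Poly_Mapping.single l f)
       (Laurent_prod (Poly_Mapping.single m g) (Poly_Mapping.single (p - l - m) h))" for p
  have "?X s - ?Y s = 0"
  proof (rule Laurent_tail_eq_zero[of F "\<lambda>s. ?X s - ?Y s"])
    fix p k
    have "l + m + (p - l - m) = p" by simp
    then show "Poly_Mapping.lookup (F p) k = (if k \<le> p then ?X (nat (p - k)) - ?Y (nat (p - k)) else 0)"
      unfolding F_def lookup_minus lookup_Laurent_prod_assoc_left lookup_Laurent_prod_assoc_right by simp
  next
    fix p
    have "coeff_class (Laurent_prod (Laurent_prod (Poly_Mapping.single l f) (Poly_Mapping.single m g))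
      (Poly_Mapping.single (p - l - m) h)) = coeff_class (Laurent_prod (Poly_Mapping.single l f)
       (Laurent_prod (Poly_Mapping.single m g) (Poly_Mapping.single (p - l - m) h)))"
      unfolding Coeff_mult[symmetric] using assms unfolding conformal_associative_def by simp
    then show "\<exists>H. total_derivative H = F p" unfolding coeff_class_eq_iff F_def by metis
  qed
  then show ?thesis by simp
qed

lemma gbinomial_nat_eq_zero: "k < n \<Longrightarrow> (of_nat k gchoose n :: complex) = 0"
  by (simp flip: binomial_gbinomial)

text \<open>The case \<open>l = n\<close>, \<open>m = -1\<close> of the associativity identity: on the side of \<open>(f \<circ>_j g) \<circ> h\<close>
  the binomial coefficients vanish except for \<open>j = n\<close>.\<close>

lemma cprod_cprod_left:
  assumes conformal_associative
  shows "cprod k (cprod n f g) h =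
    (\<Sum>j\<le>n. [:(-1) ^ (n - j) * of_nat (n choose j):] *s cprod j f (cprod (n + k - j) g h))"
proof -
  have minus1: "((-1) gchoose i :: complex) = (-1) ^ i" for i
    using gbinomial_minus[of "1 :: complex" i] by (simp flip: binomial_gbinomial)
  have "(\<Sum>j\<le>n + k. [:(of_int (int n) gchoose j) * (of_int (int n + (-1) - int j) gchoose (n + k - j)):] *s
            cprod (n + k - j) (cprod j f g) h) = [:(-1) ^ k:] *s cprod k (cprod n f g) h"
  proof -
    have "[:(of_int (int n) gchoose j) * (of_int (int n + (-1) - int j) gchoose (n + k - j)):] *s
            cprod (n + k - j) (cprod j f g) h = (if j = n then [:(-1) ^ k:] *s cprod k (cprod n f g) h else 0)"
      if "j \<le> n + k" for j
    proof -
      \<comment> \<open>For \<open>j < n\<close> the second upper index \<open>n-1-j\<close> is a natural number below the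
        lower index; for \<open>j > n\<close> the first binomial coefficient vanishes.\<close>
      consider "j < n" | "j = n" | "j > n" by linarith
      then show ?thesis
      proof cases
        case 1
        then have "int n + (-1) - int j = int (n - 1 - j)" by linarith
        then have "of_int (int n + (-1) - int j) = (of_nat (n - 1 - j) :: complex)"
          by (simp only: of_int_of_nat_eq)
        then have "(of_int (int n + (-1) - int j) gchoose (n + k - j) :: complex) = 0"
          using 1 by (simp only:) (rule gbinomial_nat_eq_zero, simp)
        then show ?thesis using 1 by (simp only: mult_zero_right) simp
      next
        case 2
        then show ?thesis by (simp add: minus1 flip: binomial_gbinomial)
      next
        case 3
        then show ?thesis using gbinomial_nat_eq_zero[of n j] by simp
      qed
    qed
    then have "(\<Sum>j\<le>n + k. [:(of_int (int n) gchoose j) * (of_int (int n + (-1) - int j) gchoose (n + k - j)):] *s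
            cprod (n + k - j) (cprod j f g) h) =
        (\<Sum>j\<le>n + k. if j = n then [:(-1) ^ k:] *s cprod k (cprod n f g) h else 0)"
      by (intro sum.cong) (simp_all only: atMost_iff)
    then show ?thesis by simp
  qed
  also have "(\<Sum>j\<le>n + k. [:(of_int (int n) gchoose j) * (of_int (int n + (-1) - int j) gchoose (n + k - j)):] *s
            cprod (n + k - j) (cprod j f g) h) =
         (\<Sum>j\<le>n + k. [:(of_int (int n) gchoose j) * (of_int (-1) gchoose (n + k - j)):] *s
            cprod j f (cprod (n + k - j) g h))"
    by (rule associativity_identity[OF assms])
  also have "\<dots> = (\<Sum>j\<le>n. [:(of_int (int n) gchoose j) * (of_int (-1) gchoose (n + k - j)):] *s
            cprod j f (cprod (n + k - j) g h))"
    by (rule sum.mono_neutral_right) (auto simp: gbinomial_nat_eq_zero)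
  also have "\<dots> = (\<Sum>j\<le>n. [:(-1) ^ k:] *s [:(-1) ^ (n - j) * of_nat (n choose j):] *s
            cprod j f (cprod (n + k - j) g h))"
  proof (rule sum.cong)
    fix j assume "j \<in> {..n}"
    then have "n + k - j = k + (n - j)" by simp
    then have "(of_int (int n) gchoose j) * (of_int (-1) gchoose (n + k - j)) =
        ((-1) ^ k * ((-1) ^ (n - j) * of_nat (n choose j)) :: complex)"
      by (simp add: minus1 power_add binomial_gbinomial del: One_nat_def)
    then show "[:(of_int (int n) gchoose j) * (of_int (-1) gchoose (n + k - j)):] *s
            cprod j f (cprod (n + k - j) g h) = [:(-1) ^ k:] *s [:(-1) ^ (n - j) * of_nat (n choose j):] *s
            cprod j f (cprod (n + k - j) g h)"
      unfolding cscale_mult by simp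
  qed simp
  also have "\<dots> = [:(-1) ^ k:] *s (\<Sum>j\<le>n. [:(-1) ^ (n - j) * of_nat (n choose j):] *s
            cprod j f (cprod (n + k - j) g h))"
    by (simp only: scale_sum_right)
  finally show ?thesis
    by (subst (asm) cspace.scale_cancel_left) simp
qed

text \<open>The case \<open>l = k\<close>, \<open>m = 0\<close> of the associativity identity.\<close>

lemma cprod_cprod_0_right:
  assumes conformal_associative
  shows "cprod k f (cprod 0 g h) =
    (\<Sum>j\<le>k. [:of_nat (k choose j):] *s cprod (k - j) (cprod j f g) h)"
proof -
  have "(\<Sum>j\<le>k. [:(of_int (int k) gchoose j) * (of_int (int k + 0 - int j) gchoose (k - j)):] *s
            cprod (k - j) (cprod j f g) h) =
         (\<Sum>j\<le>k. [:(of_int (int k) gchoose j) * (of_int 0 gchoose (k - j)):] *s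
            cprod j f (cprod (k - j) g h))"
    by (rule associativity_identity[OF assms])
  also have "\<dots> = (\<Sum>j\<le>k. if j = k then cprod k f (cprod 0 g h) else 0)"
    by (rule sum.cong) (auto simp: gbinomial_0_left simp flip: binomial_gbinomial)
  also have "(\<Sum>j\<le>k. [:(of_int (int k) gchoose j) * (of_int (int k + 0 - int j) gchoose (k - j)):] *s
            cprod (k - j) (cprod j f g) h) =
     (\<Sum>j\<le>k. [:of_nat (k choose j):] *s cprod (k - j) (cprod j f g) h)"
  proof (rule sum.cong)
    fix j assume "j \<in> {..k}"
    then have "of_int (int k + 0 - int j) = (of_nat (k - j) :: complex)"
      by (simp add: of_nat_diff)
    then show "[:(of_int (int k) gchoose j) * (of_int (int k + 0 - int j) gchoose (k - j)):] *s
            cprod (k - j) (cprod j f g) h = [:of_nat (k choose j):] *s cprod (k - j) (cprod j f g) h"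
      by (simp flip: binomial_gbinomial)
  qed simp
  finally show ?thesis by simp
qed

end

section \<open>The base of a unital conformal algebra\<close>

text \<open>The polynomial \<open>(-\<partial>)^j / j!\<close>, which lowers products by \<open>j\<close> with a binomial factor.\<close>

definition divided_power :: "nat \<Rightarrow> complex poly" where
  "divided_power j = monom ((-1) ^ j / fact j) j"

lemma divided_power_0: "divided_power 0 = [:1:]"
  by (simp add: divided_power_def monom_0)

lemma divided_power_Suc:
  "[:of_nat (Suc j):] * divided_power (Suc j) = - ([:0, 1:] * divided_power j)"
proof -
  have "- (of_nat (Suc j) * ((-1) ^ j / (of_nat (Suc j) * fact j))) = - ((-1) ^ j / fact j :: complex)"
    by (simp del: of_nat_Suc)
  then show ?thesis
    by (simp add: divided_power_def monom_Suc smult_monom minus_monom del: of_nat_Suc)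
qed

locale unital_conformal_algebra = conformal_algebra scale cprod
  for scale :: "complex poly \<Rightarrow> 'c::ab_group_add \<Rightarrow> 'c" (infixr \<open>*s\<close> 75) and cprod +
  fixes e :: 'c
  assumes associative: conformal_associative
    and identity: "conformal_identity e"
    and annihilator: "left_annihilator = {0}"
begin

lemma e_cprod [simp]: "cprod 0 e f = f"
  using identity by (simp add: conformal_identity_def)

lemma e_cprod_e: "n > 0 \<Longrightarrow> cprod n e e = 0"
  using identity by (simp add: conformal_identity_def)

lemma cprod_0_cprod: "cprod k (cprod 0 f g) h = cprod 0 f (cprod k g h)"
  using cprod_cprod_left[OF associative, of k 0 f g h] by simp

text \<open>So \<open>e \<circ>_n\<close> is the \<open>n\<close>-th power of \<open>e \<circ>_1\<close>: expanding \<open>(e \<circ>_1 e) \<circ>_k f = 0\<close> gives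
  \<open>e \<circ>_1 (e \<circ>_k f) = e \<circ>_(k+1) f\<close>.\<close>

lemma e_cprod_cprod: "cprod m e (cprod n e f) = cprod (m + n) e f"
proof -
  have one: "cprod 1 e (cprod k e f) = cprod (Suc k) e f" for k
    using cprod_cprod_left[OF associative, of k 1 e e f] by (simp add: e_cprod_e)
  show ?thesis
  proof (induction m)
    case (Suc m)
    have "cprod (Suc m) e (cprod n e f) = cprod 1 e (cprod m e (cprod n e f))"
      using cprod_cprod_left[OF associative, of m 1 e e "cprod n e f"] by (simp add: e_cprod_e)
    then show ?case using one[of "m + n"] by (simp add: Suc)
  qed simp
qed

text \<open>The elements \<open>f\<close> whose coefficients satisfy \<open>f(n) = f(0) t^n\<close>.\<close>

definition base :: "'c set" where
  "base = {f. \<forall>n>0. cprod n f e = 0}"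

lemma base_cprod_e: "f \<in> base \<Longrightarrow> n > 0 \<Longrightarrow> cprod n f e = 0"
  by (simp add: base_def)

lemma e_in_base: "e \<in> base"
  by (simp add: base_def e_cprod_e)

text \<open>When \<open>(f \<circ>_n g) \<circ>_k e\<close> is expanded, only products \<open>g \<circ>_i e\<close> with \<open>i \<ge> k\<close> occur.\<close>

lemma cprod_in_base: "g \<in> base \<Longrightarrow> cprod n f g \<in> base"
  unfolding base_def by (simp add: cprod_cprod_left[OF associative])

lemma base_subspace: "cspace.subspace base"
  by (rule cspace.subspaceI) (auto simp: base_def cprod_add_left cprod_scale_left)

lemmas base_zero = cspace.subspace_0[OF base_subspace]
  and base_add = cspace.subspace_add[OF base_subspace]
  and base_uminus = cspace.subspace_neg[OF base_subspace]
  and base_diff = cspace.subspace_diff[OF base_subspace]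
  and base_scale = cspace.subspace_scale[OF base_subspace]

lemma base_sum: "(\<And>i. i \<in> I \<Longrightarrow> h i \<in> base) \<Longrightarrow> (\<Sum>i\<in>I. h i) \<in> base"
  by (rule cspace.subspace_sum[OF base_subspace])

lemma cprod_divided_power:
  "cprod k (divided_power j *s u) h = [:of_nat (k choose j):] *s cprod (k - j) u h"
proof (induction j arbitrary: k)
  case 0
  then show ?case by (simp add: divided_power_0)
next
  case (Suc j)
  have "[:of_nat (Suc j):] *s cprod k (divided_power (Suc j) *s u) h =
      cprod k (([:of_nat (Suc j):] * divided_power (Suc j)) *s u) h"
    by (simp only: cprod_scale_left flip: scale_scale)
  also have "\<dots> = - cprod k ([:0, 1:] *s divided_power j *s u) h"
    unfolding divided_power_Suc by (simp only: scale_minus_left cprod_uminus_left scale_scale)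
  also have "\<dots> = [:of_nat k:] *s cprod (k - 1) (divided_power j *s u) h"
    by (simp only: cprod_sesquilinear of_nat_scale minus_minus)
  also have "\<dots> = [:of_nat (k * (k - 1 choose j)):] *s cprod (k - Suc j) u h"
    by (simp add: Suc)
  also have "\<dots> = [:of_nat (Suc j * (k choose Suc j)):] *s cprod (k - Suc j) u h"
    using binomial_absorption[of j k] by (cases k) (simp_all del: binomial_Suc_Suc mult_Suc)
  also have "\<dots> = [:of_nat (Suc j):] *s [:of_nat (k choose Suc j):] *s cprod (k - Suc j) u h"
    unfolding cscale_mult of_nat_mult ..
  finally show ?case
    by (subst (asm) cspace.scale_cancel_left) (simp del: of_nat_Suc)
qed

text \<open>This is where triviality of the left annihilator is used. The difference \<open>g\<close> of the two
  sides satisfies \<open>g \<circ>_k h = 0\<close>, because \<open>f \<circ>_k h = f \<circ>_k (e \<circ>_0 h)\<close> expands into exactly the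
  terms produced by the divided powers.\<close>

lemma expansion:
  assumes N: "\<And>j. j \<ge> N \<Longrightarrow> cprod j f e = 0"
  shows "f = (\<Sum>j<N. divided_power j *s cprod j f e)"
proof -
  define g where "g = f - (\<Sum>j<N. divided_power j *s cprod j f e)"
  have "cprod k g h = 0" for k h
  proof -
    have "(\<Sum>j<N. cprod k (divided_power j *s cprod j f e) h) =
        (\<Sum>j<N. [:of_nat (k choose j):] *s cprod (k - j) (cprod j f e) h)"
      by (simp only: cprod_divided_power)
    also have "\<dots> = (\<Sum>j\<in>{..<N} \<union> {..k}. [:of_nat (k choose j):] *s cprod (k - j) (cprod j f e) h)"
      by (rule sum.mono_neutral_left) (auto simp: N)
    also have "\<dots> = (\<Sum>j\<le>k. [:of_nat (k choose j):] *s cprod (k - j) (cprod j f e) h)"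
      by (rule sum.mono_neutral_right) auto
    also have "\<dots> = cprod k f (cprod 0 e h)"
      by (simp only: cprod_cprod_0_right[OF associative])
    finally show ?thesis by (simp add: g_def cprod_diff_left cprod_sum_left)
  qed
  then have "g \<in> left_annihilator" by (simp add: left_annihilator_def)
  then show ?thesis using annihilator by (simp add: g_def)
qed

lemma base_cprod_0_e [simp]: "f \<in> base \<Longrightarrow> cprod 0 f e = f"
  using expansion[of 1 f] by (simp add: base_cprod_e divided_power_0)

text \<open>As \<open>f = f \<circ>_0 e\<close>, every product with left factor \<open>f\<close> reduces to the product \<open>\<circ>_0\<close> and the
  operators \<open>e \<circ>_n\<close>.\<close>

lemma base_cprod: "f \<in> base \<Longrightarrow> cprod n f g = cprod 0 f (cprod n e g)"
  using cprod_0_cprod[of n f e g] by simp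

lemma cprod_e_in_base: "cprod n f e \<in> base"
  by (rule cprod_in_base[OF e_in_base])

lemma in_span_components: "f \<in> span {cprod j f e | j. True}"
proof -
  obtain N where N: "\<And>j. j \<ge> N \<Longrightarrow> cprod j f e = 0" using locality by blast
  define V where "V = span {cprod j f e | j. True}"
  have "(\<Sum>j<N. divided_power j *s cprod j f e) \<in> V"
    unfolding V_def by (intro span_sum span_scale span_base) blast
  moreover have "f = (\<Sum>j<N. divided_power j *s cprod j f e)"
    using N by (rule expansion)
  ultimately have "f \<in> V" by metis
  then show ?thesis by (simp add: V_def)
qed

lemma span_base_eq_UNIV: "span base = UNIV"
  using in_span_components span_mono[of "{cprod j f e | j. True}" base for f] cprod_e_in_base
  by blast

text \<open>Multiplication by \<open>e\<close> recovers \<open>p\<close> from \<open>p(\<partial>) f\<close>: each of the \<open>k\<close> factors \<open>\<partial>\<close> consumed by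
  \<open>\<circ>_k\<close> contributes \<open>-1\<close> and one factor of \<open>k!\<close>.\<close>

lemma cprod_poly_e:
  assumes "f \<in> base"
  shows "cprod k (p *s f) e = [:(-1) ^ k * fact k * coeff p k:] *s f"
proof (induction p arbitrary: k)
  case 0
  then show ?case by simp
next
  case (pCons a p)
  have "pCons a p = [:a:] + [:0, 1:] * p" by simp
  then have "cprod k (pCons a p *s f) e = cprod k ([:a:] *s f) e + cprod k ([:0, 1:] *s p *s f) e"
    by (metis cprod_add_left scale_left_distrib scale_scale)
  also have "\<dots> = [:a:] *s cprod k f e - [:of_nat k:] *s cprod (k - 1) (p *s f) e"
    unfolding cprod_scale_left cprod_sesquilinear of_nat_scale by simp
  also have "\<dots> = [:(-1) ^ k * fact k * coeff (pCons a p) k:] *s f"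
    using assms by (cases k) (simp_all add: base_cprod_e pCons.IH algebra_simps
        flip: cspace.scale_minus_left del: of_nat_Suc)
  finally show ?case .
qed

text \<open>Multiplying \<open>\<partial>H_n + (n+1) H_(n+1) = F_n\<close> by \<open>e\<close> with \<open>\<circ>_(k+1)\<close> kills the right-hand side
  and expresses \<open>H_n \<circ>_k e\<close> by \<open>H_(n+1) \<circ>_(k+1) e\<close>. Descending from the top of the support of
  \<open>H\<close>, all \<open>H_n \<circ>_k e\<close> vanish, and then so does \<open>F_n = F_n \<circ>_0 e\<close>.\<close>

lemma base_Laurent_not_exact:
  assumes base: "\<And>n. Poly_Mapping.lookup F n \<in> base" and exact: "total_derivative H = F"
  shows "F = 0"
proof (rule poly_mapping_eqI)
  obtain M where M: "\<And>n. n \<ge> M \<Longrightarrow> Poly_Mapping.lookup H n = 0"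
  proof -
    have "finite (Poly_Mapping.keys H)" by simp
    then have "bdd_above (Poly_Mapping.keys H)" by (rule bdd_above_finite)
    then obtain m where "\<And>n. n \<in> Poly_Mapping.keys H \<Longrightarrow> n \<le> m" by (auto simp: bdd_above_def)
    then have "Poly_Mapping.lookup H n = 0" if "n \<ge> m + 1" for n
      using that by (force simp: in_keys_iff)
    then show thesis using that by blast
  qed
  have *: "cprod k (Poly_Mapping.lookup F n) e =
      - ([:of_nat k:] *s cprod (k - 1) (Poly_Mapping.lookup H n) e)
      + [:of_int (n + 1):] *s cprod k (Poly_Mapping.lookup H (n + 1)) e" for k n
    unfolding exact[symmetric] total_derivative_lookup cprod_add_left cprod_sesquilinear
      cprod_scale_left of_nat_scale ..
  have H: "cprod k (Poly_Mapping.lookup H n) e = 0" for k n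
  proof (cases "n \<ge> M")
    case False
    then have "n \<le> M" by simp
    then show ?thesis
    proof (induction n arbitrary: k rule: int_le_induct)
      case base then show ?case by (simp add: M)
    next
      case (step i)
      have "[:of_nat (Suc k):] *s cprod k (Poly_Mapping.lookup H (i - 1)) e = 0"
        using *[of "Suc k" "i - 1"] base_cprod_e[OF base, of "Suc k" "i - 1"] step.IH by simp
      then show ?case by (metis cspace.scale_eq_0_iff of_nat_eq_0_iff nat.distinct(1))
    qed
  qed (simp add: M)
  show "Poly_Mapping.lookup F n = Poly_Mapping.lookup 0 n" for n
    using *[of 0 n] base_cprod_0_e[OF base, of n] H by simp
qed

section \<open>The degree zero subalgebra and its derivation\<close>

definition zero_coeff :: "'c \<Rightarrow> (int \<Rightarrow>\<^sub>0 'c) set" where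
  "zero_coeff f = coeff_class (Poly_Mapping.single 0 f)"

text \<open>The elements \<open>f(0)\<close> with \<open>f\<close> in the base. The field \<open>one\<close> has to be set because the
  coefficient algebra leaves it unspecified.\<close>

definition degree_zero :: "(complex, (int \<Rightarrow>\<^sub>0 'c) set) module" where
  "degree_zero = Coeff\<lparr>carrier := zero_coeff ` base, one := zero_coeff e\<rparr>"

definition from_zero_coeff :: "(int \<Rightarrow>\<^sub>0 'c) set \<Rightarrow> 'c" where
  "from_zero_coeff = inv_into base zero_coeff"

text \<open>The commutator with \<open>t = e(1)\<close>: in the coefficient algebra,
  \<open>f(0) t - t f(0) = (- e \<circ>_1 f)(0)\<close>.\<close>

definition shift_derivation :: "(int \<Rightarrow>\<^sub>0 'c) set \<Rightarrow> (int \<Rightarrow>\<^sub>0 'c) set" where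
  "shift_derivation x = zero_coeff (- cprod 1 e (from_zero_coeff x))"

lemma coeff_class_inj_base:
  assumes "\<And>n. Poly_Mapping.lookup F n \<in> base" "\<And>n. Poly_Mapping.lookup G n \<in> base" "coeff_class F = coeff_class G"
  shows "F = G"
proof -
  obtain H where "total_derivative H = F - G" using assms(3) unfolding coeff_class_eq_iff by metis
  then have "F - G = 0"
    by (rule base_Laurent_not_exact[rotated]) (simp add: lookup_minus base_diff assms)
  then show ?thesis by simp
qed

lemma inj_zero_coeff: "inj_on zero_coeff base"
proof (rule inj_onI)
  fix f g assume "f \<in> base" "g \<in> base" "zero_coeff f = zero_coeff g"
  then have "Poly_Mapping.single (0::int) f = Poly_Mapping.single 0 g"
    unfolding zero_coeff_def by (intro coeff_class_inj_base) (auto simp: lookup_single when_def base_zero)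
  then show "f = g" using inj_single[of "0::int"] by (simp add: inj_eq)
qed

lemma from_zero_coeff [simp]: "f \<in> base \<Longrightarrow> from_zero_coeff (zero_coeff f) = f"
  by (simp add: from_zero_coeff_def inv_into_f_f[OF inj_zero_coeff])

lemma degree_zero_carrier: "carrier degree_zero = zero_coeff ` base"
  and degree_zero_one: "\<one>\<^bsub>degree_zero\<^esub> = zero_coeff e"
  and degree_zero_zero: "\<zero>\<^bsub>degree_zero\<^esub> = zero_coeff 0"
  by (simp_all add: degree_zero_def Coeff_zero zero_coeff_def)

lemma degree_zero_add: "zero_coeff f \<oplus>\<^bsub>degree_zero\<^esub> zero_coeff g = zero_coeff (f + g)"
  by (simp add: degree_zero_def Coeff_add zero_coeff_def single_add)

lemma degree_zero_mult: "zero_coeff f \<otimes>\<^bsub>degree_zero\<^esub> zero_coeff g = zero_coeff (cprod 0 f g)"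
proof -
  have "Laurent_prod (Poly_Mapping.single 0 f) (Poly_Mapping.single 0 g) =
      Poly_Mapping.single 0 (cprod 0 f g)"
    by (rule poly_mapping_eqI)
       (auto simp: Laurent_prod_single lookup_monomial_prod monomial_prod_coeff_def lookup_single when_def
          gbinomial_0_left)
  then show ?thesis by (simp add: degree_zero_def Coeff_mult zero_coeff_def)
qed

lemma degree_zero_smult: "z \<odot>\<^bsub>degree_zero\<^esub> zero_coeff f = zero_coeff ([:z:] *s f)"
proof -
  have "Laurent_scale z (Poly_Mapping.single 0 f) = Poly_Mapping.single 0 ([:z:] *s f)"
    by (rule poly_mapping_eqI) (auto simp: lookup_single when_def)
  then show ?thesis by (simp add: degree_zero_def Coeff_smult zero_coeff_def)
qed

lemmas degree_zero_simps = degree_zero_carrier degree_zero_one degree_zero_zero degree_zero_add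
  degree_zero_mult degree_zero_smult

lemma ring_degree_zero: "ring degree_zero"
proof (rule ringI)
  show "abelian_group degree_zero"
  proof (rule abelian_groupI)
    show "\<exists>y\<in>carrier degree_zero. y \<oplus>\<^bsub>degree_zero\<^esub> x = \<zero>\<^bsub>degree_zero\<^esub>"
      if x: "x \<in> carrier degree_zero" for x
    proof -
      obtain f where "f \<in> base" "x = zero_coeff f" using x by (auto simp: degree_zero_carrier)
      then show ?thesis
        by (intro bexI[of _ "zero_coeff (- f)"]) (auto simp: degree_zero_simps base_uminus)
    qed
  qed (auto simp: degree_zero_simps base_add base_zero add_ac)
  show "Group.monoid degree_zero"
    by (rule monoidI) (auto simp: degree_zero_simps e_in_base cprod_in_base cprod_0_cprod)
qed (auto simp: degree_zero_simps cprod_add_left cprod_add_right)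

lemma unital_algebra_degree_zero: "unital_algebra degree_zero"
  unfolding unital_algebra_def
proof (intro conjI)
  show "ring degree_zero" by (rule ring_degree_zero)
  show "Module.module (ring_of_type_algebra :: complex ring) degree_zero"
  proof (rule moduleI)
    show "cring (ring_of_type_algebra :: complex ring)"
      by (rule cring_from_type_algebra)
    show "abelian_group degree_zero" by (rule ring.is_abelian_group[OF ring_degree_zero])
  qed (auto simp: degree_zero_simps base_scale scale_left_distrib scale_right_distrib
        ring_of_type_algebra_def cspace.scale_left_distrib mult.commute)
qed (auto simp: degree_zero_simps cprod_scale_left cprod_scale_right)

lemma shift_derivation_zero_coeff:
  "f \<in> base \<Longrightarrow> shift_derivation (zero_coeff f) = zero_coeff (- cprod 1 e f)"
  by (simp add: shift_derivation_def)

lemma shift_derivation_funpow: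
  "f \<in> base \<Longrightarrow> (shift_derivation ^^ i) (zero_coeff f) = zero_coeff ([:(-1) ^ i:] *s cprod i e f)"
proof (induction i)
  case (Suc i)
  then have "(shift_derivation ^^ Suc i) (zero_coeff f)
      = zero_coeff (- cprod 1 e ([:(-1) ^ i:] *s cprod i e f))"
    by (simp add: shift_derivation_zero_coeff base_scale cprod_in_base)
  then show ?case by (simp add: cprod_scale_right e_cprod_cprod)
qed simp

text \<open>In the expansion of \<open>(e \<circ>_1 f) \<circ>_0 g\<close> the term that remains besides \<open>e \<circ>_1 (f \<circ>_0 g)\<close> is
  \<open>f \<circ>_1 g\<close>, and this is \<open>f \<circ>_0 (e \<circ>_1 g)\<close> for \<open>f\<close> in the base.\<close>

lemma e_cprod_1_Leibniz:
  assumes "f \<in> base"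
  shows "cprod 1 e (cprod 0 f g) = cprod 0 (cprod 1 e f) g + cprod 0 f (cprod 1 e g)"
  using cprod_cprod_left[OF associative, of 0 1 e f g] base_cprod[OF assms, of 1 g] by simp

lemma locally_nilpotent_shift_derivation: "locally_nilpotent_derivation degree_zero shift_derivation"
  unfolding locally_nilpotent_derivation_def
proof (intro conjI ballI allI)
  fix x assume "x \<in> carrier degree_zero"
  then obtain f where f: "f \<in> base" "x = zero_coeff f" by (auto simp: degree_zero_carrier)
  show "shift_derivation x \<in> carrier degree_zero"
    using f by (simp add: shift_derivation_zero_coeff degree_zero_carrier base_uminus cprod_in_base)
  obtain N where "cprod N e f = 0" using locality[of e f] by blast
  then show "\<exists>k. (shift_derivation ^^ k) x = \<zero>\<^bsub>degree_zero\<^esub>"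
    using f by (intro exI[of _ N]) (simp add: shift_derivation_funpow degree_zero_zero)
  show "shift_derivation (c \<odot>\<^bsub>degree_zero\<^esub> x) = c \<odot>\<^bsub>degree_zero\<^esub> shift_derivation x" for c
    using f by (simp add: degree_zero_simps shift_derivation_zero_coeff base_scale cprod_scale_right)
  fix y assume "y \<in> carrier degree_zero"
  then obtain g where g: "g \<in> base" "y = zero_coeff g" by (auto simp: degree_zero_carrier)
  show "shift_derivation (x \<oplus>\<^bsub>degree_zero\<^esub> y) = shift_derivation x \<oplus>\<^bsub>degree_zero\<^esub> shift_derivation y"
    using f g by (simp add: degree_zero_simps shift_derivation_zero_coeff base_add cprod_add_right)
  show "shift_derivation (x \<otimes>\<^bsub>degree_zero\<^esub> y) = (shift_derivation x \<otimes>\<^bsub>degree_zero\<^esub> y)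
      \<oplus>\<^bsub>degree_zero\<^esub> (x \<otimes>\<^bsub>degree_zero\<^esub> shift_derivation y)"
    using f g by (simp add: degree_zero_simps shift_derivation_zero_coeff cprod_in_base
        e_cprod_1_Leibniz[simplified] cprod_uminus_left cprod_uminus_right algebra_simps)
qed

section \<open>The localized Ore extension\<close>

lemma finsum_degree_zero:
  assumes "finite I" "\<And>i. i \<in> I \<Longrightarrow> h i \<in> base" "\<And>i. i \<in> I \<Longrightarrow> x i = zero_coeff (h i)"
  shows "(\<Oplus>\<^bsub>degree_zero\<^esub>i\<in>I. x i) = zero_coeff (\<Sum>i\<in>I. h i)"
  using assms
proof (induction I rule: finite_induct)
  case empty
  then show ?case
    by (simp add: abelian_monoid.finsum_empty[OF abelian_group.axioms(1)[OF ring.is_abelian_group[OF ring_degree_zero]]]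
        degree_zero_zero)
next
  case (insert i I)
  have "(\<Oplus>\<^bsub>degree_zero\<^esub>i\<in>insert i I. x i) = x i \<oplus>\<^bsub>degree_zero\<^esub> (\<Oplus>\<^bsub>degree_zero\<^esub>i\<in>I. x i)"
    by (rule abelian_monoid.finsum_insert[OF abelian_group.axioms(1)[OF ring.is_abelian_group[OF ring_degree_zero]]])
       (use insert in \<open>auto simp: degree_zero_carrier\<close>)
  then show ?case using insert by (simp add: degree_zero_add)
qed

definition base_Laurent :: "(int \<Rightarrow>\<^sub>0 'c) set" where
  "base_Laurent = {F. \<forall>n. Poly_Mapping.lookup F n \<in> base}"

text \<open>A Laurent polynomial over the base as an element of the Ore extension; its \<open>n\<close>-th
  coefficient \<open>f\<close> becomes \<open>f(0)\<close>.\<close>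

definition ore_element :: "(int \<Rightarrow>\<^sub>0 'c) \<Rightarrow> int \<Rightarrow> (int \<Rightarrow>\<^sub>0 'c) set" where
  "ore_element F = (\<lambda>n. zero_coeff (Poly_Mapping.lookup F n))"

lemma zero_coeff_eq_iff: "f \<in> base \<Longrightarrow> g \<in> base \<Longrightarrow> zero_coeff f = zero_coeff g \<longleftrightarrow> f = g"
  using inj_zero_coeff by (auto simp: inj_on_def)

lemma bij_ore_element:
  "bij_betw ore_element base_Laurent (carrier (ore_Laurent degree_zero shift_derivation))"
proof (rule bij_betw_imageI)
  show "inj_on ore_element base_Laurent"
    by (rule inj_onI, rule poly_mapping_eqI)
       (auto simp: ore_element_def base_Laurent_def fun_eq_iff zero_coeff_eq_iff)
  show "ore_element ` base_Laurent = carrier (ore_Laurent degree_zero shift_derivation)"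
  proof (intro equalityI subsetI)
    fix p assume "p \<in> ore_element ` base_Laurent"
    then show "p \<in> carrier (ore_Laurent degree_zero shift_derivation)"
      by (auto simp: ore_element_def base_Laurent_def ore_Laurent_def degree_zero_simps
          zero_coeff_eq_iff base_zero)
  next
    fix p assume p: "p \<in> carrier (ore_Laurent degree_zero shift_derivation)"
    define F where "F = Abs_poly_mapping (\<lambda>n. from_zero_coeff (p n))"
    have "finite {n. p n \<noteq> zero_coeff 0}" using p by (simp add: ore_Laurent_def degree_zero_zero)
    then have "finite {n. from_zero_coeff (p n) \<noteq> 0}"
      by (rule finite_subset[rotated]) (auto simp: base_zero)
    then have F: "Poly_Mapping.lookup F n = from_zero_coeff (p n)" for n by (simp add: F_def)
    have "p n \<in> zero_coeff ` base" for n using p by (simp add: ore_Laurent_def degree_zero_carrier)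
    then have "from_zero_coeff (p n) \<in> base" "zero_coeff (from_zero_coeff (p n)) = p n" for n
      unfolding from_zero_coeff_def by (simp_all add: inv_into_into f_inv_into_f)
    then show "p \<in> ore_element ` base_Laurent"
      by (intro image_eqI[of _ _ F]) (simp_all add: ore_element_def base_Laurent_def F)
  qed
qed

lemma monomial_prod_coeff_in_base: "b \<in> base \<Longrightarrow> monomial_prod_coeff l a m b k \<in> base"
  by (simp add: monomial_prod_coeff_def base_zero base_scale cprod_in_base)

lemma lookup_Laurent_prod:
  "Poly_Mapping.lookup (Laurent_prod F G) k =
    (\<Sum>l\<in>Poly_Mapping.keys F. \<Sum>m\<in>Poly_Mapping.keys G.
       monomial_prod_coeff l (Poly_Mapping.lookup F l) m (Poly_Mapping.lookup G m) k)"
  by (simp add: Laurent_prod_superset[OF finite_keys finite_keys order_refl order_refl]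
      lookup_sum lookup_monomial_prod)

lemma base_Laurent_closed:
  assumes "F \<in> base_Laurent" "G \<in> base_Laurent"
  shows "F + G \<in> base_Laurent" "Laurent_scale z F \<in> base_Laurent" "Laurent_prod F G \<in> base_Laurent"
  using assms
  by (simp_all add: base_Laurent_def lookup_add base_add base_scale lookup_Laurent_prod
      base_sum monomial_prod_coeff_in_base)

text \<open>The two products agree already as Laurent polynomials, before passing to classes:
  \<open>f t^n \<cdot> g t^m\<close> has the coefficients \<open>(n choose i) (f \<circ>_i g)\<close>, and
  \<open>f \<circ>_i g = f \<circ>_0 (e \<circ>_i g) = (-1)^i f \<delta>^i(g)\<close>.\<close>

lemma ore_element_mult:
  assumes F: "F \<in> base_Laurent" and G: "G \<in> base_Laurent"
  shows "ore_element F \<otimes>\<^bsub>ore_Laurent degree_zero shift_derivation\<^esub> ore_element G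
    = ore_element (Laurent_prod F G)"
proof
  fix k
  have inF: "Poly_Mapping.lookup F n \<in> base" and inG: "Poly_Mapping.lookup G n \<in> base" for n
    using F G by (simp_all add: base_Laurent_def)
  have keysF: "{n. ore_element F n \<noteq> \<zero>\<^bsub>degree_zero\<^esub>} = Poly_Mapping.keys F"
    by (auto simp: ore_element_def degree_zero_zero zero_coeff_eq_iff inF base_zero in_keys_iff)
  have keysG: "{m. ore_element G m \<noteq> \<zero>\<^bsub>degree_zero\<^esub> \<and> k \<le> n + m} = {m \<in> Poly_Mapping.keys G. k \<le> n + m}" for n
    by (auto simp: ore_element_def degree_zero_zero zero_coeff_eq_iff inG base_zero in_keys_iff)
  have summand: "(let i = nat (n + m - k) in ((-1) ^ i * (of_int n gchoose i)) \<odot>\<^bsub>degree_zero\<^esub>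
      (ore_element F n \<otimes>\<^bsub>degree_zero\<^esub> (shift_derivation ^^ i) (ore_element G m))) =
      zero_coeff (monomial_prod_coeff n (Poly_Mapping.lookup F n) m (Poly_Mapping.lookup G m) k)"
    if "k \<le> n + m" for n m
  proof -
    have "(-1) ^ i * ((-1) ^ i * c) = (c :: complex)" for i c
      by (simp flip: mult.assoc power_mult_distrib)
    then show ?thesis
      using that base_cprod[OF inF[of n], of "nat (n + m - k)" "Poly_Mapping.lookup G m"]
      by (simp add: Let_def ore_element_def shift_derivation_funpow inG degree_zero_simps
          cprod_scale_right monomial_prod_coeff_def ac_simps)
  qed
  have "(ore_element F \<otimes>\<^bsub>ore_Laurent degree_zero shift_derivation\<^esub> ore_element G) k =
    (\<Oplus>\<^bsub>degree_zero\<^esub>n\<in>Poly_Mapping.keys F. \<Oplus>\<^bsub>degree_zero\<^esub>m\<in>{m \<in> Poly_Mapping.keys G. k \<le> n + m}.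
      (let i = nat (n + m - k) in ((-1) ^ i * (of_int n gchoose i)) \<odot>\<^bsub>degree_zero\<^esub>
      (ore_element F n \<otimes>\<^bsub>degree_zero\<^esub> (shift_derivation ^^ i) (ore_element G m))))"
    by (simp add: ore_Laurent_def keysF keysG)
  also have "\<dots> = zero_coeff (\<Sum>n\<in>Poly_Mapping.keys F. \<Sum>m\<in>{m \<in> Poly_Mapping.keys G. k \<le> n + m}.
      monomial_prod_coeff n (Poly_Mapping.lookup F n) m (Poly_Mapping.lookup G m) k)"
    by (intro finsum_degree_zero base_sum)
       (auto simp: summand monomial_prod_coeff_in_base inG)
  also have "\<dots> = zero_coeff (Poly_Mapping.lookup (Laurent_prod F G) k)"
    unfolding lookup_Laurent_prod
    by (intro arg_cong[of _ _ zero_coeff] sum.cong sum.mono_neutral_left)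
       (auto simp: monomial_prod_coeff_def)
  finally show "(ore_element F \<otimes>\<^bsub>ore_Laurent degree_zero shift_derivation\<^esub> ore_element G) k
    = ore_element (Laurent_prod F G) k"
    by (simp add: ore_element_def)
qed

lemma ore_element_add:
  "ore_element F \<oplus>\<^bsub>ore_Laurent degree_zero shift_derivation\<^esub> ore_element G = ore_element (F + G)"
  by (simp add: ore_Laurent_def ore_element_def degree_zero_add lookup_add fun_eq_iff)

lemma ore_element_smult:
  "z \<odot>\<^bsub>ore_Laurent degree_zero shift_derivation\<^esub> ore_element F = ore_element (Laurent_scale z F)"
  by (simp add: ore_Laurent_def ore_element_def degree_zero_smult fun_eq_iff)

text \<open>Modulo total derivatives, a factor \<open>\<partial>\<close> can be traded for a power of \<open>t\<close>.\<close>

lemma coeff_class_single_derivative: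
  "coeff_class (Poly_Mapping.single n ([:0, 1:] *s a)) =
     coeff_class (Laurent_scale (- of_int n) (Poly_Mapping.single (n - 1) a))"
proof -
  have "Poly_Mapping.single n ([:0, 1:] *s a) - Laurent_scale (- of_int n) (Poly_Mapping.single (n - 1) a)
    = total_derivative (Poly_Mapping.single n a)"
    by (rule poly_mapping_eqI)
       (auto simp: total_derivative_single lookup_minus lookup_add lookup_single when_def)
  then show ?thesis unfolding coeff_class_eq_iff by blast
qed

lemma coeff_class_base_Laurent_add:
  assumes "coeff_class F \<in> coeff_class ` base_Laurent" "coeff_class G \<in> coeff_class ` base_Laurent"
  shows "coeff_class (F + G) \<in> coeff_class ` base_Laurent"
proof -
  obtain F' G' where "F' \<in> base_Laurent" "coeff_class F = coeff_class F'" "G' \<in> base_Laurent" "coeff_class G = coeff_class G'"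
    using assms by blast
  then show ?thesis by (metis Coeff_add base_Laurent_closed(1) imageI)
qed

lemma coeff_class_base_Laurent_scale:
  assumes "coeff_class F \<in> coeff_class ` base_Laurent"
  shows "coeff_class (Laurent_scale z F) \<in> coeff_class ` base_Laurent"
proof -
  obtain F' where "F' \<in> base_Laurent" "coeff_class F = coeff_class F'" using assms by blast
  then show ?thesis by (metis Coeff_smult base_Laurent_closed(2) imageI)
qed

text \<open>The module is spanned over \<open>\<complex>[\<partial>]\<close> by the base, and powers of \<open>\<partial>\<close> can be traded for powers
  of \<open>t\<close>.\<close>

lemma coeff_class_base_Laurent_surj: "coeff_class F \<in> coeff_class ` base_Laurent"
proof (induction F rule: poly_mapping_additive_induct)
  case zero
  show ?case by (auto simp: base_Laurent_def base_zero)
next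
  case (add F G)
  then show ?case by (rule coeff_class_base_Laurent_add)
next
    case (single n a)
    have "a \<in> span base" by (simp add: span_base_eq_UNIV)
    then show ?case
    proof (induction a arbitrary: n rule: span_induct_alt)
      case base
      show ?case by (auto simp: base_Laurent_def base_zero)
    next
      case (step p f a)
      have "coeff_class (Poly_Mapping.single n (p *s f)) \<in> coeff_class ` base_Laurent" for n
      proof (induction p arbitrary: n)
        case 0
        show ?case by (auto simp: base_Laurent_def base_zero)
      next
        case (pCons c p)
        have "Poly_Mapping.single n f \<in> base_Laurent"
          using step by (simp add: base_Laurent_def lookup_single when_def base_zero)
        then have "coeff_class (Laurent_scale c (Poly_Mapping.single n f)) \<in> coeff_class ` base_Laurent"
          by (intro coeff_class_base_Laurent_scale imageI)
        moreover have "coeff_class (Poly_Mapping.single n ([:0, 1:] *s p *s f)) \<in> coeff_class ` base_Laurent"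
          unfolding coeff_class_single_derivative by (intro coeff_class_base_Laurent_scale pCons.IH)
        moreover have "Poly_Mapping.single n (pCons c p *s f) =
            Laurent_scale c (Poly_Mapping.single n f) + Poly_Mapping.single n ([:0, 1:] *s p *s f)"
          by (rule poly_mapping_eqI)
             (auto simp: lookup_add lookup_single when_def simp flip: scale_left_distrib)
        ultimately show ?case by (metis coeff_class_base_Laurent_add)
      qed
      then show ?case using step by (simp add: single_add coeff_class_base_Laurent_add)
    qed
qed

lemma bij_coeff_class_base_Laurent: "bij_betw coeff_class base_Laurent (carrier Coeff)"
proof (rule bij_betw_imageI)
  show "inj_on coeff_class base_Laurent"
    by (rule inj_onI) (auto simp: base_Laurent_def intro: coeff_class_inj_base)
  show "coeff_class ` base_Laurent = carrier Coeff"
    using coeff_class_base_Laurent_surj by (auto simp: carrier_Coeff)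
qed

lemma ore_Laurent_iso_Coeff:
  "\<exists>\<phi>. algebra_iso (ore_Laurent degree_zero shift_derivation) Coeff \<phi>"
proof (intro exI)
  let ?O = "ore_Laurent degree_zero shift_derivation"
  define \<psi> where "\<psi> = inv_into base_Laurent ore_element"
  have bij: "bij_betw \<psi> (carrier ?O) base_Laurent"
    unfolding \<psi>_def by (rule bij_betw_inv_into[OF bij_ore_element])
  have \<psi>: "\<psi> (ore_element F) = F" if "F \<in> base_Laurent" for F
    using bij_ore_element that unfolding \<psi>_def bij_betw_def by (simp add: inv_into_f_f)
  have ex: "\<exists>F\<in>base_Laurent. x = ore_element F" if "x \<in> carrier ?O" for x
    using bij_ore_element that unfolding bij_betw_def by blast
  show "algebra_iso ?O Coeff (coeff_class \<circ> \<psi>)"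
    unfolding algebra_iso_def
  proof (intro conjI ballI allI)
    show "bij_betw (coeff_class \<circ> \<psi>) (carrier ?O) (carrier Coeff)"
      by (rule bij_betw_trans[OF bij bij_coeff_class_base_Laurent])
    fix x assume "x \<in> carrier ?O"
    then obtain F where F: "F \<in> base_Laurent" "x = ore_element F" using ex by blast
    show "(coeff_class \<circ> \<psi>) (c \<odot>\<^bsub>?O\<^esub> x) = c \<odot>\<^bsub>Coeff\<^esub> (coeff_class \<circ> \<psi>) x" for c
      using F base_Laurent_closed by (simp add: \<psi> ore_element_smult Coeff_smult)
    fix y assume "y \<in> carrier ?O"
    then obtain G where G: "G \<in> base_Laurent" "y = ore_element G" using ex by blast
    show "(coeff_class \<circ> \<psi>) (x \<oplus>\<^bsub>?O\<^esub> y) = (coeff_class \<circ> \<psi>) x \<oplus>\<^bsub>Coeff\<^esub> (coeff_class \<circ> \<psi>) y"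
      using F G base_Laurent_closed by (simp add: \<psi> ore_element_add Coeff_add)
    show "(coeff_class \<circ> \<psi>) (x \<otimes>\<^bsub>?O\<^esub> y) = (coeff_class \<circ> \<psi>) x \<otimes>\<^bsub>Coeff\<^esub> (coeff_class \<circ> \<psi>) y"
      using F G base_Laurent_closed by (simp add: \<psi> ore_element_mult Coeff_mult)
  qed
qed

end

section \<open>Ranks and growth exponents\<close>

text \<open>Gaussian elimination without division: if \<open>v j0 i \<noteq> 0\<close>, the unknown \<open>c j0\<close> can be
  eliminated by means of equation \<open>i\<close> after multiplying the other unknowns by \<open>v j0 i\<close>.\<close>

lemma homogeneous_system_nontrivial:
  fixes v :: "'j \<Rightarrow> 'i \<Rightarrow> 'a::idom"
  assumes "finite I" "finite J" "card I < card J"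
  shows "\<exists>c. (\<exists>j\<in>J. c j \<noteq> 0) \<and> (\<forall>i\<in>I. (\<Sum>j\<in>J. c j * v j i) = 0)"
  using assms
proof (induction I arbitrary: J v rule: finite_induct)
  case empty
  then have "J \<noteq> {}" by auto
  then show ?case by (intro exI[of _ "\<lambda>_. 1"]) auto
next
  case (insert i I)
  show ?case
  proof (cases "\<forall>j\<in>J. v j i = 0")
    case True
    obtain c where "\<exists>j\<in>J. c j \<noteq> 0" "\<forall>i\<in>I. (\<Sum>j\<in>J. c j * v j i) = 0"
      using insert.IH[of J v] insert.prems insert.hyps by auto
    then show ?thesis using True by (intro exI[of _ c]) auto
  next
    case False
    then obtain j0 where j0: "j0 \<in> J" "v j0 i \<noteq> 0" by blast
    define w where "w j k = v j0 i * v j k - v j i * v j0 k" for j k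
    have "card I < card (J - {j0})" using insert.prems insert.hyps j0 by simp
    then obtain c where c: "\<exists>j\<in>J - {j0}. c j \<noteq> 0" "\<forall>k\<in>I. (\<Sum>j\<in>J - {j0}. c j * w j k) = 0"
      using insert.IH[of "J - {j0}" w] insert.prems by auto
    define d where "d j = (if j = j0 then - (\<Sum>j\<in>J - {j0}. c j * v j i) else c j * v j0 i)" for j
    have d: "(\<Sum>j\<in>J. d j * v j k) = (\<Sum>j\<in>J - {j0}. c j * w j k)" for k
    proof -
      have "(\<Sum>j\<in>J. d j * v j k) = d j0 * v j0 k + (\<Sum>j\<in>J - {j0}. d j * v j k)"
        by (rule sum.remove) (use insert.prems j0 in auto)
      also have "(\<Sum>j\<in>J - {j0}. d j * v j k) = (\<Sum>j\<in>J - {j0}. c j * v j0 i * v j k)"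
        by (rule sum.cong) (auto simp: d_def)
      also have "d j0 * v j0 k = (\<Sum>j\<in>J - {j0}. - (c j * v j i * v j0 k))"
        by (simp add: d_def sum_negf sum_distrib_right)
      finally show ?thesis
        by (simp add: w_def algebra_simps flip: sum.distrib)
    qed
    show ?thesis
    proof (intro exI[of _ d] conjI ballI)
      show "\<exists>j\<in>J. d j \<noteq> 0" using c(1) j0 by (auto simp: d_def)
      fix k assume "k \<in> insert i I"
      then show "(\<Sum>j\<in>J. d j * v j k) = 0"
        unfolding d using c(2) by (auto simp: w_def)
    qed
  qed
qed

text \<open>A factor \<open>q\<close> in the argument changes \<open>ln r\<close> only by the constant \<open>ln q\<close>, which disappears
  after division by \<open>ln r\<close>. The convention \<open>ln 0 = 0\<close> keeps \<open>ln\<close> monotone on the natural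
  numbers.\<close>

lemma growth_exponent_rescale:
  assumes le: "\<And>r. r \<ge> 1 \<Longrightarrow> d r \<le> D (q * r)" and q: "q > 0"
  shows "growth_exponent d \<le> growth_exponent D"
proof (rule dense_ge)
  fix c assume c: "growth_exponent D < c"
  show "growth_exponent d \<le> c"
  proof (cases c)
    case (real z)
    have "\<forall>\<^sub>F n in sequentially. ereal (ln (real (D n)) / ln (real n)) < ereal z"
      using c unfolding growth_exponent_def real by (rule Limsup_lessD)
    then have "\<forall>\<^sub>F n in sequentially. ln (real (D n)) / ln (real n) < z" by simp
    then have "\<forall>\<^sub>F r in sequentially. ln (real (D (q * r))) / ln (real (q * r)) < z"
      using mult_nat_left_at_top[OF q] by (rule eventually_compose_filterlim)
    then have "\<forall>\<^sub>F r in sequentially. ereal (ln (real (d r)) / ln (real r))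
        \<le> ereal (z * ln (real q) / ln (real r) + z)"
      using eventually_gt_at_top[of 1]
    proof eventually_elim
      case (elim r)
      have "1 * r \<le> q * r" using q by (intro mult_le_mono1) simp
      then have "q * r > 1" using elim(2) by linarith
      then have "ln (real (q * r)) > 0" by (intro ln_gt_zero) (metis of_nat_1 of_nat_less_iff)
      then have "ln (real (D (q * r))) < z * ln (real (q * r))"
        using elim(1) by (simp add: divide_less_eq)
      also have "ln (real (q * r)) = ln (real q) + ln (real r)"
        using q elim(2) by (simp add: ln_mult)
      finally have "ln (real (D (q * r))) < z * ln (real q) + z * ln (real r)" by (simp add: algebra_simps)
      moreover have "ln (real (d r)) \<le> ln (real (D (q * r)))"
      proof (cases "d r = 0")
        case True
        then show ?thesis by (cases "D (q * r) = 0") auto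
      next
        case False
        then show ?thesis using le[of r] elim(2) by simp
      qed
      moreover have pos: "ln (real r) > 0" using elim(2) by simp
      moreover have "(z * ln (real q) / ln (real r) + z) * ln (real r) = z * ln (real q) + z * ln (real r)"
        using pos by (simp add: distrib_right)
      ultimately show ?case by (simp add: pos_divide_le_eq)
    qed
    then have "growth_exponent d \<le> limsup (\<lambda>r. ereal (z * ln (real q) / ln (real r) + z))"
      unfolding growth_exponent_def by (rule Limsup_mono)
    also have "\<dots> = ereal z"
    proof (rule lim_imp_Limsup)
      have "((\<lambda>r. z * ln (real q) / ln (real r)) \<longlongrightarrow> 0) sequentially"
        by (intro tendsto_divide_0[OF tendsto_const] filterlim_at_top_imp_at_infinity
            filterlim_compose[OF ln_at_top filterlim_real_sequentially])
      then have "((\<lambda>r. z * ln (real q) / ln (real r) + z) \<longlongrightarrow> 0 + z) sequentially"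
        by (intro tendsto_add tendsto_const)
      then show "((\<lambda>r. ereal (z * ln (real q) / ln (real r) + z)) \<longlongrightarrow> ereal z) sequentially"
        by simp
    qed simp
    finally show ?thesis unfolding real .
  next
    case MInf
    then show ?thesis using c by simp
  qed simp
qed

context conformal_algebra
begin

text \<open>Expressing more than \<open>card G\<close> elements by \<open>G\<close> gives a homogeneous linear system over the
  domain \<open>\<complex>[\<partial>]\<close> with more unknowns than equations.\<close>

lemma independent_card_le:
  assumes G: "finite G" and B: "B \<subseteq> span G" "finite B" "independent B"
  shows "card B \<le> card G"
proof (rule ccontr)
  assume "\<not> card B \<le> card G"
  have "\<forall>b\<in>B. \<exists>u. b = (\<Sum>x\<in>G. u x *s x)"
    using B(1) unfolding span_finite[OF G] by blast
  then obtain v where v: "\<And>b. b \<in> B \<Longrightarrow> b = (\<Sum>x\<in>G. v b x *s x)" by metis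
  obtain c where c: "\<exists>b\<in>B. c b \<noteq> 0" "\<forall>x\<in>G. (\<Sum>b\<in>B. c b * v b x) = 0"
    using homogeneous_system_nontrivial[of G B v] G B(2) \<open>\<not> card B \<le> card G\<close> by auto
  have "(\<Sum>b\<in>B. c b *s b) = (\<Sum>b\<in>B. \<Sum>x\<in>G. (c b * v b x) *s x)"
  proof (rule sum.cong)
    fix b assume "b \<in> B"
    have "c b *s b = c b *s (\<Sum>x\<in>G. v b x *s x)" using v[OF \<open>b \<in> B\<close>] by simp
    then show "c b *s b = (\<Sum>x\<in>G. (c b * v b x) *s x)" by (simp add: scale_sum_right)
  qed simp
  also have "\<dots> = (\<Sum>x\<in>G. (\<Sum>b\<in>B. c b * v b x) *s x)"
    by (subst sum.swap) (simp add: scale_sum_left)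
  also have "\<dots> = 0" using c(2) by simp
  finally have "\<And>b. b \<in> B \<Longrightarrow> c b = 0"
    using independentD[OF B(3,2) subset_refl] by blast
  then show False using c(1) by blast
qed

lemma cspace_span_subset_span: "cspace.span G \<subseteq> span G"
  by (rule cspace.span_minimal)
     (auto intro: cspace.subspaceI span_base span_zero span_add span_scale)

text \<open>The second part records that the supremum in the definition of the rank is one of a
  bounded set of natural numbers; for unbounded sets it would be meaningless.\<close>

lemma module_rank_le_dim:
  assumes "finite G" "M \<subseteq> span G"
  shows "module_rank M \<le> cspace.dim G"
    and "\<And>B. B \<subseteq> M \<Longrightarrow> finite B \<Longrightarrow> independent B \<Longrightarrow> card B \<le> module_rank M"
proof -
  obtain Y where Y: "Y \<subseteq> G" "cspace.independent Y" "G \<subseteq> cspace.span Y" "card Y = cspace.dim G"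
    using cspace.basis_exists[of G] by metis
  have "finite Y" using Y(1) assms(1) finite_subset by blast
  have "span G \<subseteq> span Y"
    by (rule span_minimal) (use Y(3) cspace_span_subset_span in auto)
  then have bound: "n \<le> cspace.dim G" if "n \<in> {card B | B. B \<subseteq> M \<and> finite B \<and> independent B}" for n
    using that independent_card_le[OF \<open>finite Y\<close>] assms(2) Y(4) by fastforce
  show "module_rank M \<le> cspace.dim G"
    unfolding module_rank_def
  proof (rule cSup_least)
    show "{card B | B. B \<subseteq> M \<and> finite B \<and> independent B} \<noteq> {}"
      using independent_empty by blast
  qed (rule bound)
  fix B assume "B \<subseteq> M" "finite B" "independent B"
  then show "card B \<le> module_rank M"
    unfolding module_rank_def using bound by (intro cSup_upper bdd_aboveI) blast+
qed

lemma cprod_span_left: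
  assumes "\<And>n x. x \<in> G \<Longrightarrow> cprod n x b \<in> span Z" "a \<in> span G"
  shows "cprod n a b \<in> span Z"
  using assms(2)
proof (induction a arbitrary: n rule: span_induct_alt)
  case (step p x a)
  have "cprod n (p *s x) b \<in> span Z" for n
  proof (induction p arbitrary: n)
    case (pCons c p)
    have "pCons c p *s x = [:c:] *s x + [:0, 1:] *s p *s x"
      by (simp flip: scale_left_distrib)
    then have "cprod n (pCons c p *s x) b = [:c:] *s cprod n x b - of_nat n *s cprod (n - 1) (p *s x) b"
      by (simp only: cprod_add_left cprod_scale_left cprod_sesquilinear) simp
    then show ?case using assms(1)[OF step(1)] pCons.IH by (simp add: span_diff span_scale)
  qed (simp add: span_zero)
  then show ?case using step by (simp add: cprod_add_left span_add)
qed (simp add: span_zero)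

lemma cprod_span_right:
  assumes "\<And>n y. y \<in> Y \<Longrightarrow> cprod n a y \<in> span Z" "b \<in> span Y"
  shows "cprod n a b \<in> span Z"
  using assms(2)
proof (induction b arbitrary: n rule: span_induct_alt)
  case (step p y b)
  have "cprod n a (p *s y) \<in> span Z" for n
  proof (induction p arbitrary: n)
    case (pCons c p)
    have 1: "pCons c p *s y = [:c:] *s y + [:0, 1:] *s p *s y"
      by (simp flip: scale_left_distrib)
    have 2: "cprod n a ([:0, 1:] *s p *s y) =
        [:0, 1:] *s cprod n a (p *s y) + of_nat n *s cprod (n - 1) a (p *s y)"
      unfolding cprod_derivation cprod_sesquilinear by simp
    show ?case unfolding 1 cprod_add_right 2 cprod_scale_right
      using assms(1)[OF step(1)] pCons.IH by (intro span_add span_scale) auto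
  qed (simp add: span_zero)
  then show ?case using step by (simp add: cprod_add_right span_add)
qed (simp add: span_zero)

text \<open>Products are not \<open>\<complex>[\<partial>]\<close>-bilinear, but \<open>\<partial>\<close> can be moved out of either factor at the price
  of lowering the index of the product, so the hypothesis has to cover all indices.\<close>

lemma cprod_span:
  assumes "\<And>n x y. x \<in> G \<Longrightarrow> y \<in> Y \<Longrightarrow> cprod n x y \<in> span Z" "a \<in> span G" "b \<in> span Y"
  shows "cprod n a b \<in> span Z"
  by (rule cprod_span_right[OF _ assms(3)], rule cprod_span_left[OF _ assms(2)], rule assms(1))

lemma filtration_mono: "i \<le> j \<Longrightarrow> filtration S i \<subseteq> filtration S j"
  unfolding filtration_def by (rule span_mono) (auto intro: le_trans)

lemma filtration_cprod:
  assumes "a \<in> filtration S i" "b \<in> filtration S j"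
  shows "cprod n a b \<in> filtration S (i + j)"
  using assms unfolding filtration_def
proof (rule cprod_span[rotated])
  fix n x y assume "x \<in> {w. \<exists>k\<le>i. conformal_monomial S k w}" "y \<in> {w. \<exists>k\<le>j. conformal_monomial S k w}"
  then show "cprod n x y \<in> span {w. \<exists>k\<le>i + j. conformal_monomial S k w}"
    by (auto intro!: span_base) (meson add_mono conformal_monomial.product)
qed

lemma generator_in_filtration: "s \<in> S \<Longrightarrow> s \<in> filtration S 1"
  unfolding filtration_def
  by (rule span_base) (blast intro: conformal_monomial.generator)

lemma generates_filtration:
  assumes "generates S"
  shows "\<exists>r. a \<in> filtration S r"
proof -
  have "conformal_subalgebra {a. \<exists>r. a \<in> filtration S r}"
    unfolding conformal_subalgebra_def
  proof (intro conjI subspaceI allI ballI)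
    show "0 \<in> {a. \<exists>r. a \<in> filtration S r}" by (simp add: filtration_def span_zero)
    fix x assume x: "x \<in> {a. \<exists>r. a \<in> filtration S r}"
    then obtain i where i: "x \<in> filtration S i" by blast
    then show "p *s x \<in> {a. \<exists>r. a \<in> filtration S r}" for p
      unfolding filtration_def by (blast intro: span_scale)
    fix y assume "y \<in> {a. \<exists>r. a \<in> filtration S r}"
    then obtain j where j: "y \<in> filtration S j" by blast
    have "x \<in> filtration S (i + j)" "y \<in> filtration S (i + j)"
      using i j filtration_mono[of i "i + j" S] filtration_mono[of j "i + j" S] by auto
    then show "x + y \<in> {a. \<exists>r. a \<in> filtration S r}"
      unfolding filtration_def by (blast intro: span_add)
    show "cprod n x y \<in> {a. \<exists>r. a \<in> filtration S r}" for n
      using filtration_cprod[OF i j] by blast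
  qed
  then have "conformal_subalgebra hull S \<subseteq> {a. \<exists>r. a \<in> filtration S r}"
    using generator_in_filtration by (intro hull_minimal) blast+
  then show ?thesis using assms unfolding generates_def by blast
qed

lemma finite_cprods: "finite {cprod j a b | j. True}"
proof -
  obtain N where N: "\<And>j. j \<ge> N \<Longrightarrow> cprod j a b = 0" using locality by blast
  have "cprod j a b \<in> insert 0 ((\<lambda>j. cprod j a b) ` {..<N})" for j
    using N[of j] by (cases "j < N") auto
  then have "{cprod j a b | j. True} \<subseteq> insert 0 ((\<lambda>j. cprod j a b) ` {..<N})" by blast
  then show ?thesis by (rule finite_subset) simp
qed

end

section \<open>Words in the base and the filtration by generators\<close>

context unital_conformal_algebra
begin

definition words :: "'c set \<Rightarrow> nat \<Rightarrow> 'c set" where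
  "words T r = {foldr (cprod 0) us e | us. set us \<subseteq> T \<and> length us \<le> r}"

lemma finite_words: "finite T \<Longrightarrow> finite (words T r)"
proof -
  assume "finite T"
  have "words T r = (\<lambda>us. foldr (cprod 0) us e) ` {us. set us \<subseteq> T \<and> length us \<le> r}"
    by (auto simp: words_def)
  then show ?thesis using finite_lists_length_le[OF \<open>finite T\<close>] by simp
qed

lemma words_mono: "i \<le> j \<Longrightarrow> words T i \<subseteq> words T j"
  unfolding words_def by force

lemma words_subset_base:
  assumes "T \<subseteq> base"
  shows "words T r \<subseteq> base"
proof -
  have "foldr (cprod 0) us e \<in> base" for us
    by (induction us) (auto simp: e_in_base cprod_in_base)
  then show ?thesis by (auto simp: words_def)
qed

lemma words_mult:
  assumes "x \<in> words T i" "y \<in> words T j"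
  shows "cprod 0 x y \<in> words T (i + j)"
proof -
  obtain us vs where "x = foldr (cprod 0) us e" "set us \<subseteq> T" "length us \<le> i"
    "y = foldr (cprod 0) vs e" "set vs \<subseteq> T" "length vs \<le> j"
    using assms by (auto simp: words_def)
  moreover have "cprod 0 (foldr (cprod 0) us e) (foldr (cprod 0) vs e) = foldr (cprod 0) (us @ vs) e"
    by (induction us) (simp_all add: cprod_0_cprod)
  ultimately show ?thesis unfolding words_def
    by (intro CollectI exI[of _ "us @ vs"]) auto
qed

lemma generator_in_words: "t \<in> T \<Longrightarrow> T \<subseteq> base \<Longrightarrow> t \<in> words T 1"
  unfolding words_def by (intro CollectI exI[of _ "[t]"]) auto

lemma cprod_0_cspace_span_words:
  assumes "x \<in> words T i" "y \<in> cspace.span (words T j)"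
  shows "cprod 0 x y \<in> cspace.span (words T (i + j))"
  using assms(2)
proof (induction y rule: cspace.span_induct_alt)
  case (step c y z)
  then show ?case using words_mult[OF assms(1) step(1)]
    by (simp add: cprod_add_right cprod_scale_right cspace.span_add cspace.span_scale cspace.span_base)
qed (simp add: cspace.span_zero)

text \<open>The iterated Leibniz rule \<open>e \<circ>_n (t \<circ>_0 w) = \<Sum>_j (n choose j) (e \<circ>_j t) \<circ>_0 (e \<circ>_(n-j) w)\<close>
  does not increase the length of a word.\<close>

lemma cprod_e_words:
  assumes "T \<subseteq> base" "\<And>i t. t \<in> T \<Longrightarrow> cprod i e t \<in> T" "x \<in> words T r"
  shows "cprod n e x \<in> cspace.span (words T r)"
proof -
  have "cprod n e (foldr (cprod 0) us e) \<in> cspace.span (words T (length us))" if "set us \<subseteq> T" for us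
    using that
  proof (induction us arbitrary: n)
    case Nil
    have "e \<in> words T 0" by (simp add: words_def)
    then show ?case by (cases n) (simp_all add: e_cprod_e cspace.span_base cspace.span_zero)
  next
    case (Cons t us)
    have "cprod (n - j) (cprod j e t) (foldr (cprod 0) us e) \<in> cspace.span (words T (1 + length us))" for j
    proof -
      have "cprod j e t \<in> T" using Cons.prems assms(2) by simp
      then have "cprod j e t \<in> words T 1" "cprod j e t \<in> base"
        using generator_in_words assms(1) by blast+
      moreover have "cprod (n - j) e (foldr (cprod 0) us e) \<in> cspace.span (words T (length us))"
        using Cons.IH Cons.prems by simp
      ultimately show ?thesis
        using cprod_0_cspace_span_words[of "cprod j e t" T 1] base_cprod[of "cprod j e t" "n - j"] by simp
    qed
    then show ?case
      by (simp add: cprod_cprod_0_right[OF associative] cspace.span_sum cspace.span_scale)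
  qed
  moreover obtain us where "x = foldr (cprod 0) us e" "set us \<subseteq> T" "length us \<le> r"
    using assms(3) by (auto simp: words_def)
  ultimately show ?thesis using cspace.span_mono[OF words_mono] by blast
qed

text \<open>The letters are the components \<open>s \<circ>_j e\<close> of the generators together with their images
  under all \<open>e \<circ>_i\<close>; finitely many by locality, and stable under all \<open>e \<circ>_n\<close>.\<close>

lemma filtration_subset_span_words:
  assumes "finite S"
  obtains T where "finite T" "T \<subseteq> base" "\<And>r. filtration S r \<subseteq> span (words T r)"
proof -
  define T where "T = (\<Union>s\<in>S. \<Union>u\<in>{cprod j s e | j. True}. {cprod i e u | i. True})"
  have finT: "finite T"
    unfolding T_def using assms finite_cprods by auto
  have T: "T \<subseteq> base"
    unfolding T_def using cprod_in_base cprod_e_in_base by blast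
  have closed: "cprod i e t \<in> T" if "t \<in> T" for i t
    using that unfolding T_def by (auto simp: e_cprod_cprod) blast
  have prod: "cprod n a b \<in> span (words T (i + j))"
    if "a \<in> span (words T i)" "b \<in> span (words T j)" for n a b i j
  proof (rule cprod_span[OF _ that])
    fix n x y assume x: "x \<in> words T i" and y: "y \<in> words T j"
    have "cprod n x y = cprod 0 x (cprod n e y)"
      using x words_subset_base[OF T] by (intro base_cprod) blast
    then show "cprod n x y \<in> span (words T (i + j))"
      using cprod_0_cspace_span_words[OF x cprod_e_words[OF T closed y]] cspace_span_subset_span by auto
  qed
  have mono: "w \<in> span (words T k)" if "conformal_monomial S k w" for k w
    using that
  proof (induction rule: conformal_monomial.induct)
    case (generator s)
    have "{cprod j s e | j. True} \<subseteq> words T 1"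
    proof
      fix u assume u: "u \<in> {cprod j s e | j. True}"
      then have "cprod 0 e u \<in> T" unfolding T_def using generator by blast
      then show "u \<in> words T 1" using generator_in_words T by simp
    qed
    then show ?case using in_span_components span_mono by blast
  qed (rule prod)
  have "filtration S r \<subseteq> span (words T r)" for r
    unfolding filtration_def
  proof (rule span_minimal)
    show "{w. \<exists>k\<le>r. conformal_monomial S k w} \<subseteq> span (words T r)"
      using mono span_mono[OF words_mono] by blast
  qed auto
  then show thesis using that finT T by blast
qed

lemma words_subset_filtration:
  assumes "insert e T \<subseteq> filtration S q" "r \<ge> 1"
  shows "words T r \<subseteq> filtration S (2 * q * r)"
proof -
  \<comment> \<open>A word of length \<open>k\<close> ends in \<open>e\<close>, so it is a product of \<open>k + 1 \<le> 2 r\<close> elements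
    of step \<open>q\<close>.\<close>
  have "foldr (cprod 0) us e \<in> filtration S (q * (length us + 1))" if "set us \<subseteq> T" for us
    using that
  proof (induction us)
    case (Cons t us)
    then have "cprod 0 t (foldr (cprod 0) us e) \<in> filtration S (q + q * (length us + 1))"
      using assms(1) by (intro filtration_cprod) auto
    then show ?case by (simp add: algebra_simps)
  qed (use assms(1) in simp)
  moreover have "q * (k + 1) \<le> 2 * q * r" if "k \<le> r" for k
    using mult_le_mono2[of "k + 1" "2 * r" q] that assms(2) by simp
  ultimately show ?thesis
    using filtration_mono unfolding words_def by blast
qed

text \<open>Multiplying a relation \<open>\<Sum>_v u_v(\<partial>) v = 0\<close> by \<open>e\<close> with \<open>\<circ>_k\<close> isolates the coefficients of
  \<open>\<partial>^k\<close>.\<close>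

lemma base_cspace_independent_imp_independent:
  assumes "Y \<subseteq> base" "cspace.independent Y"
  shows "independent Y"
  unfolding independent_explicit_module
proof (intro allI impI)
  fix t u v assume t: "finite t" "t \<subseteq> Y" and sum: "(\<Sum>v\<in>t. u v *s v) = 0" and v: "v \<in> t"
  have "coeff (u v) k = 0" for k
  proof -
    have "0 = cprod k (\<Sum>v\<in>t. u v *s v) e" by (simp add: sum)
    also have "\<dots> = (\<Sum>v\<in>t. [:(-1) ^ k * fact k * coeff (u v) k:] *s v)"
      unfolding cprod_sum_left using t assms(1) by (intro sum.cong) (auto simp: cprod_poly_e)
    finally have "(-1) ^ k * fact k * coeff (u v) k = 0"
      using cspace.independentD[OF assms(2) t, of "\<lambda>v. (-1) ^ k * fact k * coeff (u v) k"] v by simp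
    then show ?thesis by simp
  qed
  then show "u v = 0" by (simp add: poly_eq_iff)
qed

lemma dim_words_le_rank:
  assumes "finite S" "T \<subseteq> base" "finite T" "words T r \<subseteq> filtration S n"
  shows "cspace.dim (words T r) \<le> module_rank (filtration S n)"
proof -
  obtain Y where Y: "Y \<subseteq> words T r" "cspace.independent Y" "card Y = cspace.dim (words T r)"
    using cspace.basis_exists by metis
  obtain T' where T': "finite T'" "filtration S n \<subseteq> span (words T' n)"
    using filtration_subset_span_words[OF assms(1)] by metis
  have "card Y \<le> module_rank (filtration S n)"
  proof (rule module_rank_le_dim(2)[OF finite_words[OF T'(1)] T'(2)])
    show "Y \<subseteq> filtration S n" using Y assms by blast
    show "finite Y" using Y finite_words[OF assms(3)] finite_subset by blast
    show "independent Y"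
      using base_cspace_independent_imp_independent Y words_subset_base[OF assms(2)] by blast
  qed
  then show ?thesis using Y by simp
qed

section \<open>Gelfand-Kirillov dimension\<close>

text \<open>The next lemmas carry spans, words, independence and dimension in the degree zero
  subalgebra over to the complex vector space structure of the base, along \<open>f \<mapsto> f(0)\<close>.\<close>

lemma finsum_smult_zero_coeff:
  assumes "finite Y" "Y \<subseteq> base"
  shows "(\<Oplus>\<^bsub>degree_zero\<^esub>b\<in>zero_coeff ` Y. c b \<odot>\<^bsub>degree_zero\<^esub> b)
    = zero_coeff (\<Sum>y\<in>Y. [:c (zero_coeff y):] *s y)"
proof -
  have "(\<Oplus>\<^bsub>degree_zero\<^esub>b\<in>zero_coeff ` Y. c b \<odot>\<^bsub>degree_zero\<^esub> b)
      = zero_coeff (\<Sum>b\<in>zero_coeff ` Y. [:c b:] *s from_zero_coeff b)"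
    by (rule finsum_degree_zero)
       (use assms in \<open>auto simp: degree_zero_smult base_scale subset_iff\<close>)
  also have "(\<Sum>b\<in>zero_coeff ` Y. [:c b:] *s from_zero_coeff b) = (\<Sum>y\<in>Y. [:c (zero_coeff y):] *s y)"
    by (subst sum.reindex[OF inj_on_subset[OF inj_zero_coeff assms(2)]])
       (use assms(2) in \<open>auto intro!: sum.cong\<close>)
  finally show ?thesis .
qed

lemma algebra_words_degree_zero:
  assumes "T \<subseteq> base"
  shows "algebra_words degree_zero (zero_coeff ` T) r = zero_coeff ` words T r"
proof -
  have fold: "foldr (\<otimes>\<^bsub>degree_zero\<^esub>) (map zero_coeff us) \<one>\<^bsub>degree_zero\<^esub> = zero_coeff (foldr (cprod 0) us e)" for us
    by (induction us) (simp_all add: degree_zero_one degree_zero_mult)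
  have "{ws. set ws \<subseteq> zero_coeff ` T \<and> length ws \<le> r} = map zero_coeff ` {us. set us \<subseteq> T \<and> length us \<le> r}"
  proof -
    have "ws \<in> map zero_coeff ` {us. set us \<subseteq> T \<and> length us \<le> r}"
      if "set ws \<subseteq> zero_coeff ` T" "length ws \<le> r" for ws
    proof -
      have "ws \<in> lists (zero_coeff ` T)" using that by auto
      then obtain us where "us \<in> lists T" "ws = map zero_coeff us" unfolding lists_image by blast
      then show ?thesis using that by auto
    qed
    then show ?thesis by (auto simp: subset_iff)
  qed
  then have "algebra_words degree_zero (zero_coeff ` T) r =
      (\<lambda>ws. foldr (\<otimes>\<^bsub>degree_zero\<^esub>) ws \<one>\<^bsub>degree_zero\<^esub>) ` map zero_coeff ` {us. set us \<subseteq> T \<and> length us \<le> r}"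
    unfolding algebra_words_def setcompr_eq_image by (rule arg_cong)
  also have "\<dots> = zero_coeff ` words T r"
    unfolding words_def setcompr_eq_image image_image fold ..
  finally show ?thesis .
qed

lemma algebra_span_degree_zero:
  assumes "G \<subseteq> base"
  shows "algebra_span degree_zero (zero_coeff ` G) = zero_coeff ` cspace.span G"
proof (intro equalityI subsetI)
  fix x assume "x \<in> algebra_span degree_zero (zero_coeff ` G)"
  then obtain B c where B: "finite B" "B \<subseteq> zero_coeff ` G"
    and x: "x = (\<Oplus>\<^bsub>degree_zero\<^esub>b\<in>B. c b \<odot>\<^bsub>degree_zero\<^esub> b)"
    unfolding algebra_span_def by blast
  obtain Y where Y: "Y \<subseteq> G" "finite Y" "B = zero_coeff ` Y"
    using finite_subset_image[OF B] by blast
  then have "x = zero_coeff (\<Sum>y\<in>Y. [:c (zero_coeff y):] *s y)"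
    unfolding x using finsum_smult_zero_coeff[of Y c] assms by auto
  moreover have "(\<Sum>y\<in>Y. [:c (zero_coeff y):] *s y) \<in> cspace.span G"
    using Y by (intro cspace.span_sum cspace.span_scale cspace.span_base) auto
  ultimately show "x \<in> zero_coeff ` cspace.span G" by blast
next
  fix x assume "x \<in> zero_coeff ` cspace.span G"
  then obtain Y u where Y: "finite Y" "Y \<subseteq> G" and x: "x = zero_coeff (\<Sum>y\<in>Y. [:u y:] *s y)"
    unfolding cspace.span_explicit by blast
  have "x = (\<Oplus>\<^bsub>degree_zero\<^esub>b\<in>zero_coeff ` Y. u (from_zero_coeff b) \<odot>\<^bsub>degree_zero\<^esub> b)"
    using finsum_smult_zero_coeff[of Y "\<lambda>b. u (from_zero_coeff b)"] Y assms
    by (auto simp: x subset_iff intro!: arg_cong[of _ _ zero_coeff] sum.cong)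
  then show "x \<in> algebra_span degree_zero (zero_coeff ` G)"
    unfolding algebra_span_def using Y
    by (intro CollectI exI[of _ "zero_coeff ` Y"] exI[of _ "\<lambda>b. u (from_zero_coeff b)"]) auto
qed

lemma algebra_independent_degree_zero:
  assumes "finite Y" "Y \<subseteq> base"
  shows "algebra_independent degree_zero (zero_coeff ` Y) \<longleftrightarrow> cspace.independent Y"
proof -
  have *: "(\<Oplus>\<^bsub>degree_zero\<^esub>b\<in>zero_coeff ` Y. c b \<odot>\<^bsub>degree_zero\<^esub> b) = \<zero>\<^bsub>degree_zero\<^esub>
      \<longleftrightarrow> (\<Sum>y\<in>Y. [:c (zero_coeff y):] *s y) = 0" for c
    unfolding finsum_smult_zero_coeff[OF assms] degree_zero_zero
    by (rule zero_coeff_eq_iff) (use assms in \<open>auto intro!: base_sum base_scale base_zero\<close>)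
  show ?thesis
  proof
    assume A: "algebra_independent degree_zero (zero_coeff ` Y)"
    have "\<forall>y\<in>Y. u y = 0" if "(\<Sum>y\<in>Y. [:u y:] *s y) = 0" for u
    proof -
      have "(\<Sum>y\<in>Y. [:u (from_zero_coeff (zero_coeff y)):] *s y) = (\<Sum>y\<in>Y. [:u y:] *s y)"
        using assms(2) by (intro sum.cong) auto
      then have "(\<Oplus>\<^bsub>degree_zero\<^esub>b\<in>zero_coeff ` Y. u (from_zero_coeff b) \<odot>\<^bsub>degree_zero\<^esub> b) = \<zero>\<^bsub>degree_zero\<^esub>"
        using *[of "\<lambda>b. u (from_zero_coeff b)"] that by metis
      then have "\<forall>b\<in>zero_coeff ` Y. u (from_zero_coeff b) = 0"
        using A[unfolded algebra_independent_def, THEN spec, of "\<lambda>b. u (from_zero_coeff b)"] by blast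
      then show ?thesis using assms(2) by (auto simp: subset_iff)
    qed
    then show "cspace.independent Y" unfolding cspace.dependent_finite[OF assms(1)] by blast
  next
    assume "cspace.independent Y"
    then have "\<forall>y\<in>Y. c (zero_coeff y) = 0" if "(\<Sum>y\<in>Y. [:c (zero_coeff y):] *s y) = 0" for c
      using that cspace.independentD[OF _ assms(1) subset_refl, of "\<lambda>y. c (zero_coeff y)"] by blast
    then show "algebra_independent degree_zero (zero_coeff ` Y)"
      unfolding algebra_independent_def * by (simp only: ball_simps) blast
  qed
qed

lemma algebra_dim_degree_zero:
  assumes "finite G" "G \<subseteq> base"
  shows "algebra_dim degree_zero (zero_coeff ` cspace.span G) = cspace.dim G"
  unfolding algebra_dim_def
proof (rule cSup_eq_maximum)
  have sub: "cspace.span G \<subseteq> base"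
    by (rule cspace.span_minimal[OF assms(2) base_subspace])
  obtain Y where Y: "Y \<subseteq> G" "cspace.independent Y" "G \<subseteq> cspace.span Y" "card Y = cspace.dim G"
    using cspace.basis_exists[of G] by metis
  have finY: "finite Y" using Y(1) assms(1) finite_subset by blast
  have "card (zero_coeff ` Y) = cspace.dim G"
    using Y assms by (metis card_image inj_on_subset inj_zero_coeff)
  moreover have "zero_coeff ` Y \<subseteq> zero_coeff ` cspace.span G"
    using Y(1) cspace.span_superset by blast
  moreover have "algebra_independent degree_zero (zero_coeff ` Y)"
    using algebra_independent_degree_zero[of Y] finY Y assms by blast
  ultimately show "cspace.dim G \<in> {card B | B. B \<subseteq> zero_coeff ` cspace.span G \<and> finite B \<and>
      algebra_independent degree_zero B}"
    using finY by (intro CollectI exI[of _ "zero_coeff ` Y"]) auto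
  fix n assume "n \<in> {card B | B. B \<subseteq> zero_coeff ` cspace.span G \<and> finite B \<and>
      algebra_independent degree_zero B}"
  then obtain B where B: "B \<subseteq> zero_coeff ` cspace.span G" "finite B" "algebra_independent degree_zero B"
    "n = card B" by blast
  obtain Z where Z: "Z \<subseteq> cspace.span G" "finite Z" "B = zero_coeff ` Z"
    using finite_subset_image[OF B(2,1)] by blast
  have "cspace.independent Z"
    using B(3) Z algebra_independent_degree_zero[of Z] sub by auto
  moreover have "Z \<subseteq> cspace.span Y"
    using Z(1) cspace.span_minimal[OF Y(3)] by auto
  ultimately have "card Z \<le> card Y" using cspace.independent_span_bound[OF finY] by blast
  then show "n \<le> cspace.dim G"
    using card_image_le[OF Z(2), of zero_coeff] B(4) Z(3) Y(4) by simp
qed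

lemma algebra_GKdim_degree_zero:
  "algebra_GKdim degree_zero =
     (SUP T\<in>{T. finite T \<and> T \<subseteq> base}. growth_exponent (\<lambda>r. cspace.dim (words T r)))"
proof -
  have "{S. finite S \<and> S \<subseteq> carrier degree_zero} = (`) zero_coeff ` {T. finite T \<and> T \<subseteq> base}"
    unfolding degree_zero_carrier
  proof (intro equalityI subsetI)
    fix S assume "S \<in> {S. finite S \<and> S \<subseteq> zero_coeff ` base}"
    then show "S \<in> (`) zero_coeff ` {T. finite T \<and> T \<subseteq> base}"
      using finite_subset_image[of S zero_coeff base] by blast
  qed auto
  moreover have "algebra_dim degree_zero (algebra_span degree_zero
      (algebra_words degree_zero (zero_coeff ` T) r)) = cspace.dim (words T r)"
    if "finite T" "T \<subseteq> base" for T r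
    using that by (simp add: algebra_words_degree_zero algebra_span_degree_zero words_subset_base
        algebra_dim_degree_zero finite_words)
  ultimately show ?thesis
    unfolding algebra_GKdim_def by (simp add: image_image)
qed

lemma conformal_growth_le:
  assumes "finite S"
  shows "conformal_growth S \<le> algebra_GKdim degree_zero"
proof -
  obtain T where T: "finite T" "T \<subseteq> base" "\<And>r. filtration S r \<subseteq> span (words T r)"
    using filtration_subset_span_words[OF assms] by metis
  have "conformal_growth S \<le> growth_exponent (\<lambda>r. cspace.dim (words T r))"
    unfolding conformal_growth_def
    by (rule growth_exponent_rescale[of _ _ 1])
       (use module_rank_le_dim(1)[OF finite_words[OF T(1)] T(3)] in auto)
  also have "\<dots> \<le> algebra_GKdim degree_zero"
    unfolding algebra_GKdim_degree_zero using T by (intro SUP_upper) auto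
  finally show ?thesis .
qed

lemma growth_words_le:
  assumes "finite S" "finite T" "T \<subseteq> base" "insert e T \<subseteq> filtration S q"
  shows "growth_exponent (\<lambda>r. cspace.dim (words T r)) \<le> conformal_growth S"
  unfolding conformal_growth_def
proof (rule growth_exponent_rescale)
  \<comment> \<open>Rescaling needs a positive factor, and \<open>q\<close> may be \<open>0\<close>.\<close>
  have bound: "insert e T \<subseteq> filtration S (Suc q)"
    using assms(4) filtration_mono[of q "Suc q" S] by auto
  show "cspace.dim (words T r) \<le> module_rank (filtration S (2 * Suc q * r))" if "r \<ge> 1" for r
    by (rule dim_words_le_rank[OF assms(1,3,2) words_subset_filtration[OF bound that]])
qed simp

text \<open>In the finitely generated case the definition picks some generating set; for each one,
  every finite subset of the base lies in a single step of its filtration. Otherwise a finite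
  subset \<open>T\<close> of the base is compared with the subalgebra generated by \<open>T\<close> and \<open>e\<close>.\<close>

lemma algebra_GKdim_degree_zero_eq_conformal_GKdim: "algebra_GKdim degree_zero = conformal_GKdim"
proof (cases conformal_finitely_generated)
  case True
  define S where "S = (SOME S. finite S \<and> generates S)"
  have S: "finite S" "generates S"
    using someI_ex[OF True[unfolded conformal_finitely_generated_def]] by (auto simp: S_def)
  have "algebra_GKdim degree_zero \<le> conformal_growth S"
    unfolding algebra_GKdim_degree_zero
  proof (rule SUP_least)
    fix T assume "T \<in> {T. finite T \<and> T \<subseteq> base}"
    then have T: "finite T" "T \<subseteq> base" by auto
    obtain \<rho> where \<rho>: "\<And>a. a \<in> filtration S (\<rho> a)"
      using generates_filtration[OF S(2)] by metis
    have "a \<in> filtration S (Max (\<rho> ` insert e T))" if "a \<in> insert e T" for a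
      using \<rho>[of a] filtration_mono[of "\<rho> a" "Max (\<rho> ` insert e T)" S] that T(1) by auto
    then show "growth_exponent (\<lambda>r. cspace.dim (words T r)) \<le> conformal_growth S"
      using growth_words_le[OF S(1) T] by blast
  qed
  then show ?thesis
    using True conformal_growth_le[OF S(1)] by (simp add: conformal_GKdim_def S_def)
next
  case False
  have "algebra_GKdim degree_zero \<le> (SUP S\<in>{S. finite S}. conformal_growth S)"
    unfolding algebra_GKdim_degree_zero
  proof (rule SUP_least)
    fix T assume "T \<in> {T. finite T \<and> T \<subseteq> base}"
    then have T: "finite T" "T \<subseteq> base" by auto
    have "growth_exponent (\<lambda>r. cspace.dim (words T r)) \<le> conformal_growth (insert e T)"
      by (rule growth_words_le[of _ _ 1]) (use T generator_in_filtration in auto)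
    also have "\<dots> \<le> (SUP S\<in>{S. finite S}. conformal_growth S)"
      using T by (intro SUP_upper) auto
    finally show "growth_exponent (\<lambda>r. cspace.dim (words T r)) \<le> (SUP S\<in>{S. finite S}. conformal_growth S)" .
  qed
  moreover have "(SUP S\<in>{S. finite S}. conformal_growth S) \<le> algebra_GKdim degree_zero"
    by (rule SUP_least) (simp add: conformal_growth_le)
  ultimately show ?thesis using False by (simp add: conformal_GKdim_def)
qed

text \<open>Multiplying by \<open>e\<close> with \<open>\<circ>_0\<close> fixes the base and replaces the scalars \<open>p(\<partial>)\<close> by their
  constant terms.\<close>

lemma base_inter_span_subset_cspace_span:
  assumes "W \<subseteq> base" "f \<in> base" "f \<in> span W"
  shows "f \<in> cspace.span W"
proof -
  have "cprod 0 x e \<in> cspace.span W" if "x \<in> span W" for x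
    using that
  proof (induction x rule: span_induct_alt)
    case (step p w x)
    then have "cprod 0 (p *s w) e \<in> cspace.span W"
      using assms(1) by (subst cprod_poly_e) (auto intro: cspace.span_scale cspace.span_base)
    then show ?case using step by (simp add: cprod_add_left cspace.span_add)
  qed (simp add: cspace.span_zero)
  then show ?thesis using assms by fastforce
qed

text \<open>Every element of the base lies in the \<open>\<complex>[\<partial>]\<close>-span of words in the finite set \<open>T\<close> attached
  to the generators, and hence in their \<open>\<complex>\<close>-span.\<close>

lemma degree_zero_finitely_generated:
  assumes conformal_finitely_generated
  shows "algebra_finitely_generated degree_zero"
proof -
  obtain S where S: "finite S" "generates S"
    using assms unfolding conformal_finitely_generated_def by blast
  obtain T where T: "finite T" "T \<subseteq> base" "\<And>r. filtration S r \<subseteq> span (words T r)"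
    using filtration_subset_span_words[OF S(1)] by metis
  have "unital_subalgebra degree_zero hull (zero_coeff ` T) = carrier degree_zero"
  proof (rule hull_unique)
    show "zero_coeff ` T \<subseteq> carrier degree_zero" using T(2) by (auto simp: degree_zero_carrier)
    show "unital_subalgebra degree_zero (carrier degree_zero)"
      unfolding unital_subalgebra_def
      using ring.carrier_is_subring[OF ring_degree_zero]
      by (auto simp: degree_zero_simps base_scale)
    fix H assume H: "zero_coeff ` T \<subseteq> H" "unital_subalgebra degree_zero H"
    then have subring: "subring H degree_zero" and
      scale: "\<And>c x. x \<in> H \<Longrightarrow> c \<odot>\<^bsub>degree_zero\<^esub> x \<in> H"
      by (auto simp: unital_subalgebra_def)
    note sub = subringE[OF subring]
    have "zero_coeff (foldr (cprod 0) us e) \<in> H" if "set us \<subseteq> T" for us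
      using that
    proof (induction us)
      case Nil
      then show ?case using sub(3) by (simp add: degree_zero_one)
    next
      case (Cons t us)
      then have "zero_coeff t \<otimes>\<^bsub>degree_zero\<^esub> zero_coeff (foldr (cprod 0) us e) \<in> H"
        using H(1) by (intro sub(6)) auto
      then show ?case by (simp add: degree_zero_mult)
    qed
    then have words: "zero_coeff w \<in> H" if "w \<in> words T r" for w r
      using that by (auto simp: words_def)
    have cspan: "zero_coeff f \<in> H" if "f \<in> cspace.span (words T r)" for f r
      using that
    proof (induction f rule: cspace.span_induct_alt)
      case base
      show ?case using sub(2) by (simp add: degree_zero_zero)
    next
      case (step c w f)
      then have "(c \<odot>\<^bsub>degree_zero\<^esub> zero_coeff w) \<oplus>\<^bsub>degree_zero\<^esub> zero_coeff f \<in> H"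
        using words by (intro sub(7) scale) auto
      then show ?case by (simp add: degree_zero_simps)
    qed
    show "carrier degree_zero \<subseteq> H"
    proof
      fix x assume "x \<in> carrier degree_zero"
      then obtain f where f: "f \<in> base" "x = zero_coeff f" by (auto simp: degree_zero_carrier)
      obtain r where "f \<in> span (words T r)" using generates_filtration[OF S(2)] T(3) by blast
      then have "f \<in> cspace.span (words T r)"
        using base_inter_span_subset_cspace_span[OF words_subset_base[OF T(2)] f(1)] by blast
      then show "x \<in> H" using cspan f(2) by blast
    qed
  qed
  then show ?thesis
    unfolding algebra_finitely_generated_def using T
    by (intro exI[of _ "zero_coeff ` T"]) (auto simp: degree_zero_carrier)
qed

end

theorem proposition3p5:
  fixes scale :: "complex poly \<Rightarrow> 'c::ab_group_add \<Rightarrow> 'c"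
    and cprod :: "nat \<Rightarrow> 'c \<Rightarrow> 'c \<Rightarrow> 'c"
    and e :: 'c
  assumes "conformal_algebra scale cprod"
    and "conformal_algebra.conformal_associative scale cprod"
    and "conformal_algebra.conformal_identity cprod e"
    and "conformal_algebra.left_annihilator cprod = {0}"
  shows "\<exists>(A :: (complex, (int \<Rightarrow>\<^sub>0 'c) set) module) \<delta>.
     unital_algebra A \<and> locally_nilpotent_derivation A \<delta> \<and>
     (\<exists>\<phi>. algebra_iso (ore_Laurent A \<delta>) (conformal_algebra.Coeff scale cprod) \<phi>) \<and>
     algebra_GKdim A = conformal_algebra.conformal_GKdim scale cprod \<and>
     (conformal_algebra.conformal_finitely_generated scale cprod \<longrightarrow> algebra_finitely_generated A)"
proof -
  interpret conformal_algebra scale cprod by (rule assms(1))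
  interpret unital_conformal_algebra scale cprod e
    using assms by unfold_locales auto
  show ?thesis
    using unital_algebra_degree_zero locally_nilpotent_shift_derivation ore_Laurent_iso_Coeff
      algebra_GKdim_degree_zero_eq_conformal_GKdim degree_zero_finitely_generated by blast
qed

end
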